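(* (i) Let $S\equiv\pm\{1, 4, 5, 6, 7, 9, 15, 17, 19, 20, 22, 23\}\pmod{48}$ and $T\equiv\pm\{1, 3, 4, 5, 11, 13, 14, 18, 19, 20, 21, 23\}\pmod{48}$. Then $p(S,n)=p(T,n-1)$ for all $n\geq 1$. (ii) Let $S\equiv\pm\{2, 3, 4, 5, 7, 11, 13, 17, 18, 19, 20, 21\}\pmod{48}$ and $T\equiv\pm\{1, 4, 6, 7, 9, 10, 11, 13, 15, 17, 20, 23\}\pmod{48}$. Then $p(S,n)=p(T,n)$ for all integers $n\ge0$ with $n\neq 1$.
   Context: For a set $S$ of positive integers and an integer $n\ge 0$, $p(S,n)$ denotes the number of partitions of $n$ into parts belonging to $S$ (so $p(S,0)=1$). The notation $S\equiv\pm\{r_1,\dots,r_k\}\pmod M$ means that $S$ is the set of all positive integers $n$ such that $n\equiv r_i$ or $n\equiv -r_i\pmod M$ for some $i$. *)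

theory Defs
  imports "HOL-Library.Multiset" "HOL-Number_Theory.Cong"
begin

text \<open>A partition of \<open>n\<close> into parts from \<open>S\<close> is a finite multiset of elements of \<open>S\<close> with sum \<open>n\<close>.
  The definition is meant for sets \<open>S\<close> of positive integers: if \<open>0 \<in> S\<close> the counted set can be
  infinite, and then \<^const>\<open>card\<close> returns 0.\<close>

definition partitions_into :: "nat set \<Rightarrow> nat \<Rightarrow> nat multiset set" where
  "partitions_into S n = {P. set_mset P \<subseteq> S \<and> sum_mset P = n}"

definition num_partitions :: "nat set \<Rightarrow> nat \<Rightarrow> nat" where
  "num_partitions S n = card (partitions_into S n)"

text \<open>Residues are integers, so that \<open>- r\<close> is a genuine negative and not truncated.\<close>

definition pm_residues :: "int set \<Rightarrow> int \<Rightarrow> nat set" where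
  "pm_residues R M =
     {n. 0 < n \<and> (\<exists>r\<in>R. [int n = r] (mod M) \<or> [int n = - r] (mod M))}"

lemma zero_notin_pm_residues: "0 \<notin> pm_residues R M"
  by (simp add: pm_residues_def)

lemma partition_part_le:
  fixes P :: "nat multiset"
  assumes "x \<in># P"
  shows "x \<le> sum_mset P"
proof -
  obtain Q where "P = add_mset x Q"
    using assms by (metis insert_DiffM)
  then show ?thesis by simp
qed

lemma partition_size_le:
  fixes P :: "nat multiset"
  assumes "0 \<notin># P"
  shows "size P \<le> sum_mset P"
  using assms by (induction P) auto

lemma finite_partitions_into:
  assumes "0 \<notin> S"
  shows "finite (partitions_into S n)"
proof (rule finite_subset)
  show "partitions_into S n \<subseteq> mset ` (\<Union>k\<le>n. {xs. set xs \<subseteq> {..n} \<and> length xs = k})"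
  proof
    fix P assume P: "P \<in> partitions_into S n"
    obtain xs where xs: "mset xs = P"
      using ex_mset by blast
    have sum: "sum_mset P = n" and "0 \<notin># P"
      using P assms by (auto simp: partitions_into_def)
    then have "length xs \<le> n"
      using partition_size_le[of P] xs by auto
    moreover have "set xs \<subseteq> {..n}"
    proof
      fix x assume "x \<in> set xs"
      then have "x \<in># P" using xs by auto
      then show "x \<in> {..n}" using partition_part_le[of x P] sum by simp
    qed
    ultimately show "P \<in> mset ` (\<Union>k\<le>n. {xs. set xs \<subseteq> {..n} \<and> length xs = k})"
      using xs by (intro image_eqI[of _ _ xs]) auto
  qed
  show "finite (mset ` (\<Union>k\<le>n. {xs :: nat list. set xs \<subseteq> {..n} \<and> length xs = k}))"
    by (intro finite_imageI finite_UN_I finite_lists_length_eq) auto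
qed

lemma num_partitions_0:
  assumes "0 \<notin> S"
  shows "num_partitions S 0 = 1"
proof -
  have "P = {#}" if "P \<in> partitions_into S 0" for P
  proof -
    have "0 \<notin># P" and "sum_mset P = 0"
      using that assms by (auto simp: partitions_into_def)
    then have "size P = 0"
      by (metis partition_size_le le_zero_eq)
    then show ?thesis by simp
  qed
  then have "partitions_into S 0 = {{#}}"
    by (auto simp: partitions_into_def)
  then show ?thesis by (simp add: num_partitions_def)
qed

end

theory Submission
  imports Defs "HOL-Library.Nat_Bijection" "HOL-Analysis.Infinite_Products" "HOL-Analysis.Infinite_Sum"
begin

text \<open>
  Write \<open>[a]\<close> for the product of all \<open>1 - q^n\<close> with \<open>n \<equiv> \<plusminus>a (mod 24)\<close> and \<open>{a}\<close> for the product of the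
  corresponding \<open>1 + q^n\<close>. Since \<open>r\<close> and \<open>24 - r\<close> modulo 48 merge to \<open>[r]\<close>, and \<open>2a\<close> modulo 48
  gives \<open>[a]{a}\<close>, the generating functions in (i) are the reciprocals of \<open>O[4]{3}{11}\<close> and
  \<open>O[4]{7}{9}\<close>, those in (ii) the reciprocals of \<open>O[4]{1}{9}\<close> and \<open>O[4]{3}{5}\<close>, where
  \<open>O = [1][3][5][7][9][11]\<close> satisfies \<open>O{1}{3}{5}{7}{9}{11} = [2][6][10]\<close>. Clearing denominators, the
  claims become \<open>{1}{5}{7}{9} - q{1}{3}{5}{11} = [2][4][6][10]\<close> and
  \<open>{1}{7}{9}{11} - {3}{5}{7}{11} = q[2][4][6][10]\<close>. Both are instances of the Weierstrass three-term relation
  for theta functions, which follows from the Jacobi triple product and the splitting of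
  a product of two theta series along the parity of the sum of the summation indices.
  The identities are proved for real \<open>q\<close> with \<open>0 < \<bar>q\<bar> < 1\<close> and transferred to coefficients.
\<close>

section \<open>Generating functions of partitions\<close>

text \<open>Removing one copy of \<open>s\<close> matches the partitions that contain
  \<open>s\<close> with those of \<open>n - s\<close>; the others use only \<open>A\<close>. This is
  multiplication by 1 - q^s, read on coefficients.\<close>

lemma num_partitions_insert:
  assumes "s \<notin> A" "0 < s" "0 \<notin> A"
  shows "num_partitions (insert s A) n =
    num_partitions A n + (if s \<le> n then num_partitions (insert s A) (n - s) else 0)"
proof -
  have fin: "finite (partitions_into (insert s A) m)" "finite (partitions_into A m)" for m
    using assms by (auto intro!: finite_partitions_into)
  have split: "partitions_into (insert s A) n =
      partitions_into A n \<union> {P \<in> partitions_into (insert s A) n. s \<in># P}"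
    using assms by (auto simp: partitions_into_def)
  have disj: "partitions_into A n \<inter> {P \<in> partitions_into (insert s A) n. s \<in># P} = {}"
    using assms by (auto simp: partitions_into_def)
  have "card {P \<in> partitions_into (insert s A) n. s \<in># P} =
      (if s \<le> n then card (partitions_into (insert s A) (n - s)) else 0)"
  proof (cases "s \<le> n")
    case True
    have "{P \<in> partitions_into (insert s A) n. s \<in># P} =
        add_mset s ` partitions_into (insert s A) (n - s)"
    proof (intro equalityI subsetI)
      fix P assume "P \<in> {P \<in> partitions_into (insert s A) n. s \<in># P}"
      then obtain Q where Q: "P = add_mset s Q" "P \<in> partitions_into (insert s A) n"
        by (metis (mono_tags, lifting) insert_DiffM mem_Collect_eq)
      then have "Q \<in> partitions_into (insert s A) (n - s)"
        by (auto simp: partitions_into_def)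
      then show "P \<in> add_mset s ` partitions_into (insert s A) (n - s)"
        using Q by blast
    qed (use True in \<open>auto simp: partitions_into_def\<close>)
    moreover have "inj_on (add_mset s) X" for X
      by (simp add: inj_on_def)
    ultimately show ?thesis
      using True by (simp add: card_image)
  next
    case False
    then have "{P \<in> partitions_into (insert s A) n. s \<in># P} = {}"
      using partition_part_le by (fastforce simp: partitions_into_def)
    then show ?thesis using False by (simp only: card.empty if_False)
  qed
  moreover have "card (partitions_into (insert s A) n) =
      card (partitions_into A n) + card {P \<in> partitions_into (insert s A) n. s \<in># P}"
    by (subst split, rule card_Un_disjoint) (use fin disj in auto)
  ultimately show ?thesis
    unfolding num_partitions_def by simp
qed

lemma num_partitions_empty: "num_partitions {} n = (if n = 0 then 1 else 0)"
proof -
  have "partitions_into {} n = (if n = 0 then {{#}} else {})"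
    by (auto simp: partitions_into_def)
  then show ?thesis by (simp add: num_partitions_def)
qed

lemma num_partitions_mono:
  assumes "A \<subseteq> B" "0 \<notin> B"
  shows "num_partitions A n \<le> num_partitions B n"
  unfolding num_partitions_def
proof (rule card_mono)
  show "finite (partitions_into B n)"
    using assms by (intro finite_partitions_into)
qed (use assms in \<open>auto simp: partitions_into_def\<close>)

lemma num_partitions_lessThan:
  assumes "n < N"
  shows "num_partitions (S \<inter> {..<N}) n = num_partitions S n"
proof -
  have "partitions_into (S \<inter> {..<N}) n = partitions_into S n"
    using assms partition_part_le by (fastforce simp: partitions_into_def)
  then show ?thesis by (simp add: num_partitions_def)
qed

text \<open>The recurrence is the formal identity A(x) (1 - x^s) = B(x). On partial sums it survives
  as an inequality, bounding them by B(x) / (1 - x^s); since the terms are nonnegative, boundedness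
  gives convergence.\<close>

lemma summable_shift_recurrence:
  fixes a b :: "nat \<Rightarrow> real"
  assumes rec: "\<And>n. a n = b n + (if s \<le> n then a (n - s) else 0)"
    and nonneg: "\<And>n. 0 \<le> a n" "\<And>n. 0 \<le> b n"
    and s: "0 < s" and x: "0 \<le> x" "x < 1" and summ: "summable (\<lambda>n. b n * x ^ n)"
  shows "summable (\<lambda>n. a n * x ^ n)"
proof (rule bounded_imp_summable)
  fix n
  let ?A = "\<Sum>k\<le>n. a k * x ^ k"
  have xs: "x ^ s < 1" using s x by (simp add: power_less_one_iff)
  have "(\<Sum>k\<le>n. if s \<le> k then a (k - s) * x ^ k else 0)
      = (\<Sum>k\<in>{s..n}. a (k - s) * x ^ k)"
    by (intro sum.mono_neutral_cong_right) auto
  also have "\<dots> = (\<Sum>k\<in>(\<lambda>j. j + s) ` {j. j + s \<le> n}. a (k - s) * x ^ k)"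
  proof (intro sum.cong refl)
    show "{s..n} = (\<lambda>j. j + s) ` {j. j + s \<le> n}"
    proof
      show "{s..n} \<subseteq> (\<lambda>j. j + s) ` {j. j + s \<le> n}"
      proof
        fix k assume "k \<in> {s..n}"
        then have "k = (k - s) + s" "k - s + s \<le> n" by auto
        then show "k \<in> (\<lambda>j. j + s) ` {j. j + s \<le> n}" by blast
      qed
    qed auto
  qed
  also have "\<dots> = (\<Sum>j\<in>{j. j + s \<le> n}. x ^ s * (a j * x ^ j))"
    by (subst sum.reindex) (auto simp: inj_on_def power_add mult_ac intro!: sum.cong)
  also have "\<dots> \<le> (\<Sum>j\<le>n. x ^ s * (a j * x ^ j))"
    by (intro sum_mono2) (use nonneg x in auto)
  finally have shift: "(\<Sum>k\<le>n. if s \<le> k then a (k - s) * x ^ k else 0) \<le> x ^ s * ?A"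
    by (simp add: sum_distrib_left)
  have "?A = (\<Sum>k\<le>n. b k * x ^ k + (if s \<le> k then a (k - s) * x ^ k else 0))"
    by (intro sum.cong refl) (subst rec, simp add: algebra_simps)
  also have "\<dots> = (\<Sum>k\<le>n. b k * x ^ k) + (\<Sum>k\<le>n. if s \<le> k then a (k - s) * x ^ k else 0)"
    by (rule sum.distrib)
  also have "\<dots> \<le> (\<Sum>k. b k * x ^ k) + x ^ s * ?A"
    using nonneg x summ by (intro add_mono shift sum_le_suminf) auto
  finally have "?A * (1 - x ^ s) \<le> (\<Sum>k. b k * x ^ k)"
    by (simp add: algebra_simps)
  then show "?A \<le> (\<Sum>k. b k * x ^ k) / (1 - x ^ s)"
    using xs by (simp add: field_simps)
qed (use nonneg x in auto)

text \<open>Each new part \<open>s\<close> gives the equation a = 1/p + q^s a for the sum, solved by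
  division by 1 - q^s. Convergence at \<bar>q\<bar> is carried through the induction because the
  bounding argument needs a nonnegative base, while \<open>q\<close> may be negative.\<close>

lemma partitions_gf_finite:
  fixes q :: real
  assumes "finite A" "0 \<notin> A" "\<bar>q\<bar> < 1"
  shows "summable (\<lambda>n. num_partitions A n * \<bar>q\<bar> ^ n) \<and>
    (\<lambda>n. num_partitions A n * q ^ n) sums (1 / (\<Prod>s\<in>A. 1 - q ^ s))"
  using assms(1,2)
proof (induction A rule: finite_induct)
  case empty
  have *: "(\<lambda>n. num_partitions {} n * x ^ n) = (\<lambda>n. if n = 0 then 1 else 0)" for x :: real
    by (auto simp: num_partitions_empty)
  show ?case
    unfolding * using sums_single[of 0 "\<lambda>_. 1 :: real"] by (auto simp: sums_iff)
next
  case (insert s A)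
  let ?a = "\<lambda>n. real (num_partitions (insert s A) n)"
  let ?b = "\<lambda>n. real (num_partitions A n)"
  let ?p = "\<Prod>s\<in>A. 1 - q ^ s"
  have s: "0 < s" and A: "0 \<notin> A" using insert.prems by auto
  have rec: "?a n = ?b n + (if s \<le> n then ?a (n - s) else 0)" for n
    using num_partitions_insert[OF insert.hyps(2) s A] by simp
  have summ: "summable (\<lambda>n. ?a n * \<bar>q\<bar> ^ n)"
    by (rule summable_shift_recurrence[OF rec]) (use insert.IH A s assms in auto)
  have "summable (\<lambda>n. ?a n * q ^ n)"
    by (rule summable_norm_cancel) (use summ in \<open>simp add: abs_mult power_abs\<close>)
  then obtain a where a: "(\<lambda>n. ?a n * q ^ n) sums a" by blast
  have b: "(\<lambda>n. ?b n * q ^ n) sums (1 / ?p)" using insert.IH A by blast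
  have "(\<lambda>n. q ^ s * (?a n * q ^ n)) sums (q ^ s * a)"
    by (intro sums_mult a)
  then have "(\<lambda>n. if s \<le> n then ?a (n - s) * q ^ n else 0) sums (q ^ s * a)"
    by (subst sums_zero_iff_shift[of s, symmetric]) (auto simp: power_add mult_ac)
  from sums_add[OF b this] have "(\<lambda>n. ?a n * q ^ n) sums (1 / ?p + q ^ s * a)"
    by (rule sums_cong[THEN iffD1, rotated]) (subst rec, simp add: algebra_simps)
  then have "a = 1 / ?p + q ^ s * a" using a sums_unique2 by blast
  then have "a * (1 - q ^ s) = 1 / ?p" by (simp add: algebra_simps)
  moreover have "1 - q ^ s \<noteq> 0"
    using s assms(3) by (metis abs_one eq_iff_diff_eq_0 less_irrefl power_abs power_less_one_iff abs_ge_zero)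
  ultimately have "a = 1 / ?p / (1 - q ^ s)"
    by (simp add: eq_divide_eq del: divide_divide_eq_left)
  then show ?case
    using a summ insert.hyps by (simp add: mult.commute)
qed

text \<open>Comparison with a geometric series makes the limit nonzero, and factors in (0, 1] make
  the partial products decrease. The limit is thus a uniform positive lower bound, needed both for
  partition sums and for Gaussian binomials.\<close>

lemma euler_product_limit:
  fixes x :: real
  assumes "0 \<le> x" "x < 1"
  obtains e where "0 < e" "(\<lambda>n. \<Prod>i<n. 1 - x ^ Suc i) \<longlonglongrightarrow> e"
    "\<And>n. e \<le> (\<Prod>i<n. 1 - x ^ Suc i)"
proof -
  let ?f = "\<lambda>n. \<Prod>i<n. 1 - x ^ Suc i"
  have fac: "0 < 1 - x ^ Suc i" "1 - x ^ Suc i \<le> 1" for i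
    using assms power_less_one_iff[of x "Suc i"] by auto
  have "summable (\<lambda>i. norm (- (x ^ Suc i)))"
    using summable_mult[of "\<lambda>i. x ^ i" x] assms by (auto intro!: summable_geometric simp: power_abs)
  then have "abs_convergent_prod (\<lambda>i. 1 - x ^ Suc i)"
    using summable_imp_abs_convergent_prod[of "\<lambda>i. 1 - x ^ Suc i"] by simp
  then have conv: "convergent_prod (\<lambda>i. 1 - x ^ Suc i)"
    by (rule abs_convergent_prod_imp_convergent_prod)
  have "(\<lambda>n. \<Prod>i\<le>n. 1 - x ^ Suc i) \<longlonglongrightarrow> prodinf (\<lambda>i. 1 - x ^ Suc i)"
    by (rule convergent_prod_LIMSEQ[OF conv])
  then have "(\<lambda>n. ?f (Suc n)) \<longlonglongrightarrow> prodinf (\<lambda>i. 1 - x ^ Suc i)"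
    by (simp only: lessThan_Suc_atMost)
  then have lim: "?f \<longlonglongrightarrow> prodinf (\<lambda>i. 1 - x ^ Suc i)"
    by (rule LIMSEQ_imp_Suc)
  have pos: "0 < ?f n" for n
    using fac by (intro prod_pos) auto
  have "?f (Suc n) \<le> ?f n" for n
  proof -
    have "?f n * (1 - x ^ Suc n) \<le> ?f n * 1"
      using fac pos[of n] by (intro mult_left_mono) auto
    then show ?thesis by simp
  qed
  then have dec: "decseq ?f"
    by (rule decseq_SucI)
  have nz: "prodinf (\<lambda>i. 1 - x ^ Suc i) \<noteq> 0"
  proof (rule prodinf_nonzero[OF conv])
    show "1 - x ^ Suc i \<noteq> 0" for i
      using fac(1)[of i] by linarith
  qed
  have "0 \<le> prodinf (\<lambda>i. 1 - x ^ Suc i)"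
    by (rule LIMSEQ_le_const[OF lim]) (use pos in \<open>auto intro: less_imp_le\<close>)
  with nz have "0 < prodinf (\<lambda>i. 1 - x ^ Suc i)" by linarith
  then show ?thesis
    using that[OF _ lim] decseq_ge[OF dec lim] by blast
qed

section \<open>Infinite sets of parts\<close>

text \<open>Up to degree \<open>n\<close> only parts at most \<open>n\<close> count, so a partial
  sum is bounded by a finite generating function. The Euler product limit \<open>e\<close> bounds
  all of these by 1/e at once.\<close>

lemma partitions_summable:
  fixes x :: real
  assumes "0 \<notin> S" "0 \<le> x" "x < 1"
  shows "summable (\<lambda>n. num_partitions S n * x ^ n)"
proof -
  obtain e where e: "0 < e" "\<And>n. e \<le> (\<Prod>i<n. 1 - x ^ Suc i)"
    using euler_product_limit[OF assms(2,3)] by metis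
  show ?thesis
  proof (rule bounded_imp_summable[where B = "1 / e"])
    fix n
    let ?S = "S \<inter> {..<Suc n}"
    have S: "finite ?S" "0 \<notin> ?S" using assms by auto
    have gf: "(\<lambda>k. num_partitions ?S k * x ^ k) sums (1 / (\<Prod>s\<in>?S. 1 - x ^ s))"
      using partitions_gf_finite[OF S, of x] assms by simp
    have "(\<Sum>k\<le>n. num_partitions S k * x ^ k) = (\<Sum>k\<le>n. num_partitions ?S k * x ^ k)"
      by (intro sum.cong refl) (simp add: num_partitions_lessThan del: lessThan_Suc)
    also have "\<dots> \<le> (\<Sum>k. num_partitions ?S k * x ^ k)"
      using gf assms by (intro sum_le_suminf) (auto simp: sums_iff)
    also have "\<dots> = 1 / (\<Prod>s\<in>?S. 1 - x ^ s)"
      using gf by (simp add: sums_iff)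
    also have "\<dots> \<le> 1 / e"
    proof -
      have "e \<le> (\<Prod>i<n. 1 - x ^ Suc i)" by (rule e)
      also have "\<dots> = (\<Prod>s\<in>Suc ` {..<n}. 1 - x ^ s)"
        by (subst prod.reindex) auto
      \<comment> \<open>Dropping factors that lie in [0, 1] can only increase the product.\<close>
      also have "\<dots> \<le> (\<Prod>s\<in>?S. 1 - x ^ s)"
      proof -
        have sub: "?S \<subseteq> Suc ` {..<n}"
        proof
          fix s assume "s \<in> ?S"
          then have "s = Suc (s - 1)" "s - 1 < n" using assms by (cases s; auto)+
          then show "s \<in> Suc ` {..<n}" by blast
        qed
        have fac: "0 \<le> 1 - x ^ s" "1 - x ^ s \<le> 1" for s
          using assms by (auto simp: power_le_one)
        have "(\<Prod>s\<in>Suc ` {..<n}. 1 - x ^ s) = (\<Prod>s\<in>Suc ` {..<n} - ?S. 1 - x ^ s) * (\<Prod>s\<in>?S. 1 - x ^ s)"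
          by (rule prod.subset_diff[OF sub]) auto
        also have "\<dots> \<le> 1 * (\<Prod>s\<in>?S. 1 - x ^ s)"
          by (intro mult_right_mono prod_le_1 prod_nonneg) (use fac in auto)
        finally show ?thesis by simp
      qed
      finally show ?thesis using e by (simp add: frac_le)
    qed
    finally show "(\<Sum>k\<le>n. num_partitions S k * x ^ k) \<le> 1 / e" .
  qed (use assms in auto)
qed

text \<open>Each coefficient of the truncated generating function is eventually constant, and the
  full series at \<bar>q\<bar> dominates, so Tannery's theorem applies. The relation "series times
  product is 1" then passes to the limit and yields \<open>L \<noteq> 0\<close> as well. The
  subsequence \<open>f\<close> allows the product to be known only at multiples of a
  modulus.\<close>

lemma partitions_gf:
  fixes q :: real and f :: "nat \<Rightarrow> nat"
  assumes "0 \<notin> S" "\<bar>q\<bar> < 1" "strict_mono f"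
    and lim: "(\<lambda>N. \<Prod>s\<in>S \<inter> {..<f N}. 1 - q ^ s) \<longlonglongrightarrow> L"
  shows "L \<noteq> 0" "(\<lambda>n. num_partitions S n * q ^ n) sums (1 / L)"
proof -
  let ?a = "\<lambda>k N. num_partitions (S \<inter> {..<N}) k * q ^ k"
  let ?b = "\<lambda>k. num_partitions S k * q ^ k"
  have summ: "summable (\<lambda>n. num_partitions S n * \<bar>q\<bar> ^ n)"
    using partitions_summable assms by auto
  have "(\<lambda>N. \<Sum>k. ?a k N) \<longlonglongrightarrow> (\<Sum>k. ?b k)"
  proof (rule tannerys_theorem[THEN conjunct2, THEN conjunct2])
    fix k
    have "eventually (\<lambda>N. ?a k N = ?b k) sequentially"
      using eventually_gt_at_top[of k] by eventually_elim (simp add: num_partitions_lessThan)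
    then show "(\<lambda>N. ?a k N) \<longlonglongrightarrow> ?b k"
      by (rule tendsto_eventually)
  next
    show "\<forall>\<^sub>F (k, N) in sequentially \<times>\<^sub>F sequentially. norm (?a k N) \<le> num_partitions S k * \<bar>q\<bar> ^ k"
      using assms
      by (intro always_eventually)
        (auto simp: abs_mult power_abs intro!: mult_right_mono num_partitions_mono)
  qed (use summ in auto)
  then have "(\<lambda>N. \<Sum>k. ?a k (f N)) \<longlonglongrightarrow> (\<Sum>k. ?b k)"
    using LIMSEQ_subseq_LIMSEQ[OF _ assms(3)] by (fastforce simp: o_def)
  then have lim2: "(\<lambda>N. (\<Sum>k. ?a k (f N)) * (\<Prod>s\<in>S \<inter> {..<f N}. 1 - q ^ s)) \<longlonglongrightarrow> (\<Sum>k. ?b k) * L"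
    using lim by (rule tendsto_mult)
  have "(\<Sum>k. ?a k N) * (\<Prod>s\<in>S \<inter> {..<N}. 1 - q ^ s) = 1" for N
  proof -
    have "(\<lambda>k. ?a k N) sums (1 / (\<Prod>s\<in>S \<inter> {..<N}. 1 - q ^ s))"
      using partitions_gf_finite[of "S \<inter> {..<N}" q] assms by auto
    moreover have "1 - q ^ s \<noteq> 0" if "s \<in> S" for s
    proof -
      have "\<bar>q ^ s\<bar> < 1" using that assms by (auto simp: power_abs power_less_one_iff intro!: gr0I)
      then show ?thesis by auto
    qed
    then have "(\<Prod>s\<in>S \<inter> {..<N}. 1 - q ^ s) \<noteq> 0" by auto
    ultimately show ?thesis by (simp add: sums_iff)
  qed
  with lim2 have eq: "(\<Sum>k. ?b k) * L = 1"
    by (simp add: LIMSEQ_const_iff)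
  then show "L \<noteq> 0" by auto
  have "summable ?b"
    by (rule summable_norm_cancel) (use summ in \<open>simp add: abs_mult power_abs\<close>)
  then show "?b sums (1 / L)"
    using eq \<open>L \<noteq> 0\<close> by (simp add: sums_iff field_simps)
qed

text \<open>The point 0 is left out because the theta identities divide by \<open>q\<close>. Letting
  x tend to 0 isolates the first coefficient; dividing by x then shifts the series for the
  induction.\<close>

lemma powser_sums_zero_imp_coeff_zero:
  fixes a :: "nat \<Rightarrow> real"
  assumes "\<And>x. x \<noteq> 0 \<Longrightarrow> \<bar>x\<bar> < 1 \<Longrightarrow> (\<lambda>n. a n * x ^ n) sums 0"
  shows "a n = 0"
  using assms
proof (induction n arbitrary: a)
  case 0
  have "((\<lambda>_. 0) \<longlongrightarrow> a 0) (at (0::real))"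
    by (rule powser_limit_0_strong[of 1]) (use 0 in auto)
  then show ?case
    by (simp add: tendsto_const_iff)
next
  case (Suc n)
  have a0: "a 0 = 0"
  proof -
    have "((\<lambda>_. 0) \<longlongrightarrow> a 0) (at (0::real))"
      by (rule powser_limit_0_strong[of 1]) (use Suc.prems in auto)
    then show ?thesis
      by (simp add: tendsto_const_iff)
  qed
  have "(\<lambda>n. a (Suc n)) n = 0"
  proof (rule Suc.IH)
    fix x :: real assume x: "x \<noteq> 0" "\<bar>x\<bar> < 1"
    have "(\<lambda>n. a (Suc n) * x ^ Suc n) sums 0"
      using Suc.prems[OF x] a0 by (subst sums_Suc_iff) simp
    from sums_mult[OF this, of "1 / x"] show "(\<lambda>n. a (Suc n) * x ^ n) sums 0"
      using x by (simp add: field_simps)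
  qed
  then show ?case by simp
qed

section \<open>The Jacobi triple product\<close>

text \<open>The q-Pascal recursion avoids division, so the q-binomial theorem holds for every base
  \<open>p\<close>.\<close>

fun gaussian_binomial :: "real \<Rightarrow> nat \<Rightarrow> nat \<Rightarrow> real" where
  "gaussian_binomial p n 0 = 1"
| "gaussian_binomial p 0 (Suc k) = 0"
| "gaussian_binomial p (Suc n) (Suc k) = gaussian_binomial p n k + p ^ Suc k * gaussian_binomial p n (Suc k)"

lemma gaussian_binomial_eq_0: "n < k \<Longrightarrow> gaussian_binomial p n k = 0"
  by (induction p n k rule: gaussian_binomial.induct) auto

text \<open>Splitting off the factor at i = 0 leaves the product for \<open>n\<close> at
  \<open>x * p\<close>, which is why \<open>x\<close> is generalised in the induction. Comparing
  coefficients of x^(k+1) gives the q-Pascal recursion.\<close>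

lemma q_binomial_theorem:
  "(\<Prod>i<n. 1 + x * p ^ i) = (\<Sum>k\<le>n. p ^ (k * (k - 1) div 2) * gaussian_binomial p n k * x ^ k)"
proof (induction n arbitrary: x)
  case (Suc n)
  define c where "c k = p ^ (k * (k - 1) div 2)" for k
  have c_Suc: "c (Suc k) = c k * p ^ k" for k
  proof -
    have "Suc k * (Suc k - 1) div 2 = k * (k - 1) div 2 + k"
      by (cases k) (auto simp: algebra_simps)
    then show ?thesis by (simp add: c_def power_add)
  qed
  let ?g = "\<lambda>k. c k * gaussian_binomial p n k * (x * p) ^ k"
  have "(\<Prod>i<Suc n. 1 + x * p ^ i) = (1 + x) * (\<Prod>i<n. 1 + (x * p) * p ^ i)"
    by (subst prod.lessThan_Suc_shift) (simp add: mult_ac)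
  also have "\<dots> = (1 + x) * (\<Sum>k\<le>n. ?g k)"
    by (simp add: Suc.IH c_def)
  also have "\<dots> = (\<Sum>k\<le>n. ?g k) + (\<Sum>k\<le>n. x * ?g k)"
    by (simp only: distrib_right sum_distrib_left mult_1 sum.distrib)
  \<comment> \<open>The added top term vanishes; it is there so that shifting the index aligns the
    powers of x in the two sums.\<close>
  also have "(\<Sum>k\<le>n. ?g k) = (\<Sum>k\<le>Suc n. ?g k)"
    by (simp add: gaussian_binomial_eq_0)
  also have "\<dots> = ?g 0 + (\<Sum>k\<le>n. ?g (Suc k))"
    by (rule sum.atMost_Suc_shift)
  finally have "(\<Prod>i<Suc n. 1 + x * p ^ i) = 1 + (\<Sum>k\<le>n. ?g (Suc k) + x * ?g k)"
    by (simp add: sum.distrib c_def)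
  also have "(\<Sum>k\<le>n. ?g (Suc k) + x * ?g k) = (\<Sum>k\<le>n. c (Suc k) * gaussian_binomial p (Suc n) (Suc k) * x ^ Suc k)"
    by (intro sum.cong refl) (simp add: c_Suc algebra_simps power_mult_distrib)
  also have "1 + \<dots> = (\<Sum>k\<le>Suc n. c k * gaussian_binomial p (Suc n) k * x ^ k)"
    by (subst sum.atMost_Suc_shift) (simp add: c_def)
  finally show ?case by (simp add: c_def)
qed auto

text \<open>The quotient formula with denominators cleared. The two Pascal terms contribute 1 -
  p^(k+1) and p^(k+1) (1 - p^(n-k)), which add up to 1 - p^(n+1). The case k = n is separate since
  its second Pascal term vanishes.\<close>

lemma gaussian_binomial_prod:
  assumes "k \<le> n"
  shows "gaussian_binomial p n k * (\<Prod>i<k. 1 - p ^ Suc i) * (\<Prod>i<n-k. 1 - p ^ Suc i) = (\<Prod>i<n. 1 - p ^ Suc i)"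
  using assms
proof (induction p n k rule: gaussian_binomial.induct)
  case (3 p n k)
  let ?e = "\<lambda>n. \<Prod>i<n. 1 - p ^ Suc i"
  have k: "gaussian_binomial p n k * ?e k * ?e (n - k) = ?e n" using 3 by simp
  show ?case
  proof (cases "k = n")
    case True
    then show ?thesis using k by (auto simp: gaussian_binomial_eq_0)
  next
    case False
    then have "Suc k \<le> n" and nk: "n - k = Suc (n - Suc k)" using 3 by auto
    then have k': "gaussian_binomial p n (Suc k) * ?e (Suc k) * ?e (n - Suc k) = ?e n" using 3 by blast
    have e: "?e (n - k) = ?e (n - Suc k) * (1 - p ^ (n - k))"
      unfolding nk by simp
    have "gaussian_binomial p (Suc n) (Suc k) * ?e (Suc k) * ?e (n - k) =
       (gaussian_binomial p n k * ?e k * ?e (n - k)) * (1 - p ^ Suc k) +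
       p ^ Suc k * (1 - p ^ (n - k)) * (gaussian_binomial p n (Suc k) * ?e (Suc k) * ?e (n - Suc k))"
      unfolding e by (simp add: algebra_simps)
    also have "\<dots> = ?e n * (1 - p ^ (Suc k + (n - k)))"
      unfolding k k' by (simp add: algebra_simps power_add)
    also have "Suc k + (n - k) = Suc n" using \<open>Suc k \<le> n\<close> by simp
    finally show ?thesis by (simp only: diff_Suc_Suc prod.lessThan_Suc)
  qed
qed auto

section \<open>Theta series and the infinite triple product\<close>

text \<open>The two-sided theta series with nome \<open>r\<close>. Unordered summation turns its
  symmetries into bijections of the integers.\<close>

definition jtheta :: "real \<Rightarrow> real \<Rightarrow> real" where
  "jtheta r w = (\<Sum>\<^sub>\<infinity>n::int. r powi (n * n) * w powi n)"

text \<open>The term equals (c r^n)^n, whose base is eventually below 1/2.\<close>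

lemma summable_square_power:
  fixes r c :: real
  assumes "0 < r" "r < 1" "0 < c"
  shows "summable (\<lambda>n. r ^ (n * n) * c ^ n)"
proof -
  have "(\<lambda>n. c * r ^ n) \<longlonglongrightarrow> c * 0"
    by (intro tendsto_intros LIMSEQ_power_zero) (use assms in auto)
  then have "eventually (\<lambda>n. c * r ^ n < 1/2) sequentially"
    by (rule order_tendstoD) simp
  then obtain N where N: "\<And>n. n \<ge> N \<Longrightarrow> c * r ^ n < 1/2"
    by (auto simp: eventually_sequentially)
  show ?thesis
  proof (rule summable_comparison_test)
    show "summable (\<lambda>n. (1/2::real) ^ n)" by (intro summable_geometric) auto
    show "\<exists>N. \<forall>n\<ge>N. norm (r ^ (n * n) * c ^ n) \<le> (1/2) ^ n"
    proof (intro exI allI impI)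
      fix n assume "n \<ge> N"
      have "norm (r ^ (n * n) * c ^ n) = (c * r ^ n) ^ n"
        using assms by (simp add: power_mult_distrib power_mult mult.commute)
      also have "\<dots> \<le> (1/2) ^ n"
        using N[OF \<open>n \<ge> N\<close>] assms by (intro power_mono) auto
      finally show "norm (r ^ (n * n) * c ^ n) \<le> (1/2) ^ n" .
    qed
  qed
qed

text \<open>The integers are covered by two half-lines; on the negative one \<open>w\<close> is
  replaced by its inverse. The overlap at 0 is harmless for summability.\<close>

lemma jtheta_abs_summable:
  fixes r w :: real
  assumes "0 < r" "r < 1" "w \<noteq> 0"
  shows "(\<lambda>n::int. r powi (n * n) * w powi n) abs_summable_on UNIV"
proof -
  let ?f = "\<lambda>n::int. norm (r powi (n * n) * w powi n)"
  have nat: "(\<lambda>n::nat. r ^ (n * n) * c ^ n) summable_on UNIV" if "c > 0" for c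
    using summable_square_power[OF assms(1,2) that] assms that
    by (intro norm_summable_imp_summable_on) simp
  have U: "(UNIV :: int set) = range int \<union> range (\<lambda>n. - int n)"
  proof -
    have "k \<in> range int \<union> range (\<lambda>n. - int n)" for k :: int
    proof -
      have "k = int (nat k) \<or> k = - int (nat (- k))" by auto
      then show ?thesis by blast
    qed
    then show ?thesis by blast
  qed
  have "?f summable_on range int"
  proof (subst summable_on_reindex)
    have "?f \<circ> int = (\<lambda>n. r ^ (n * n) * \<bar>w\<bar> ^ n)"
      using assms by (auto simp: abs_mult power_abs simp flip: of_nat_mult)
    then show "(?f \<circ> int) summable_on UNIV" using nat[of "\<bar>w\<bar>"] assms by simp
  qed simp
  moreover have "?f summable_on range (\<lambda>n. - int n)"
  proof (subst summable_on_reindex)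
    have "?f \<circ> (\<lambda>n. - int n) = (\<lambda>n. r ^ (n * n) * (1 / \<bar>w\<bar>) ^ n)"
      using assms by (auto simp: abs_mult power_abs power_int_minus field_simps simp flip: of_nat_mult)
    then show "(?f \<circ> (\<lambda>n. - int n)) summable_on UNIV" using nat[of "1 / \<bar>w\<bar>"] assms by simp
  qed (auto simp: inj_on_def)
  ultimately show ?thesis
    unfolding U by (rule summable_on_union)
qed

text \<open>The enumeration \<open>int_decode\<close> reduces the claim to series over the naturals;
  absolute convergence makes the order irrelevant.\<close>

lemma tannery_int:
  fixes a :: "nat \<Rightarrow> int \<Rightarrow> real"
  assumes lim: "\<And>j. (\<lambda>N. a N j) \<longlonglongrightarrow> b j"
    and bound: "\<And>N j. \<bar>a N j\<bar> \<le> M j"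
    and M: "M summable_on UNIV"
  shows "(\<lambda>N. infsum (a N) UNIV) \<longlonglongrightarrow> infsum b UNIV"
proof -
  have bij: "bij_betw int_decode UNIV UNIV" by (rule bij_int_decode)
  have M': "summable (\<lambda>k. M (int_decode k))"
    using M summable_on_reindex_bij_betw[OF bij, of M] by (simp add: summable_on_imp_summable)
  have boundb: "\<bar>b j\<bar> \<le> M j" for j
    by (rule LIMSEQ_le_const2[OF tendsto_rabs[OF lim]]) (use bound in auto)
  have suminf: "infsum f UNIV = (\<Sum>k. f (int_decode k))" if "\<And>j. \<bar>f j\<bar> \<le> M j" for f :: "int \<Rightarrow> real"
  proof -
    have s: "summable (\<lambda>k. norm (f (int_decode k)))"
      by (rule summable_comparison_test[OF _ M']) (use that in auto)
    have "((\<lambda>k. f (int_decode k)) has_sum (\<Sum>k. f (int_decode k))) UNIV"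
      by (rule norm_summable_imp_has_sum[OF s]) (use summable_norm_cancel[OF s] in auto)
    then show ?thesis
      using infsum_reindex_bij_betw[OF bij, of f] infsumI by force
  qed
  have "(\<lambda>N. \<Sum>k. a N (int_decode k)) \<longlonglongrightarrow> (\<Sum>k. b (int_decode k))"
  proof (rule tannerys_theorem[THEN conjunct2, THEN conjunct2, OF _ _ M'])
    show "\<forall>\<^sub>F (k, N) in sequentially \<times>\<^sub>F sequentially. norm (a N (int_decode k)) \<le> M (int_decode k)"
      by (intro always_eventually) (use bound in auto)
  qed (use lim in auto)
  then show ?thesis
    using suminf[of b] suminf[of "a _"] bound boundb by simp
qed

text \<open>The q-binomial theorem with base r^2 and 2N factors, at an \<open>x\<close> for which
  the exponents of \<open>r\<close> run through the odd numbers from 1 - 2N to 2N - 1. Pulling the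
  monomial out of each factor with negative exponent produces the 1/w factors; \<open>K\<close>
  collects these monomials.\<close>

lemma finite_triple_product:
  fixes r w :: real
  assumes "0 < r" "w \<noteq> 0"
  shows "(\<Prod>k<N. (1 + w * r ^ (2 * k + 1)) * (1 + r ^ (2 * k + 1) / w)) =
    (\<Sum>j\<in>{- int N..int N}. gaussian_binomial (r\<^sup>2) (2 * N) (nat (j + int N)) * (r powi (j * j) * w powi j))"
    (is "?J = ?R")
proof -
  define x where "x = w * r powi (1 - 2 * int N)"
  define K where "K = w ^ N * r powi (- (int N * int N))"
  have [simp]: "r \<noteq> 0" using assms by simp
  have "K \<noteq> 0" using assms by (simp add: K_def)
  have "(\<Prod>i<2 * N. 1 + x * (r\<^sup>2) ^ i) = (\<Prod>i<N. 1 + x * (r\<^sup>2) ^ i) * (\<Prod>k<N. 1 + x * (r\<^sup>2) ^ (N + k))"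
  proof -
    have "(\<Prod>i<N + m. f i) = (\<Prod>i<N. f i) * (\<Prod>k<m. f (N + k))" for m and f :: "nat \<Rightarrow> real"
      by (induction m) (simp_all add: mult_ac)
    then show ?thesis by (simp add: mult_2)
  qed
  \<comment> \<open>Reversing the order gives the k-th factor the exponent -(2k+1).\<close>
  also have "(\<Prod>i<N. 1 + x * (r\<^sup>2) ^ i) = (\<Prod>k<N. 1 + x * (r\<^sup>2) ^ (N - Suc k))"
    by (rule prod.nat_diff_reindex[symmetric])
  also have "\<dots> = (\<Prod>k<N. (w * r powi (- int (2 * k + 1))) * (1 + r ^ (2 * k + 1) / w))"
  proof (rule prod.cong[OF refl])
    fix k assume "k \<in> {..<N}"
    then have "x * (r\<^sup>2) ^ (N - Suc k) = w * (r powi (1 - 2 * int N) * r powi (2 * (int N - int k - 1)))"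
      by (simp add: x_def of_nat_diff power_int_def nat_mult_distrib nat_diff_distrib diff_mult_distrib2 flip: power_mult)
    also have "\<dots> = w * r powi (- int (2 * k + 1))"
      by (simp flip: power_int_add)
    finally show "1 + x * (r\<^sup>2) ^ (N - Suc k) = (w * r powi (- int (2 * k + 1))) * (1 + r ^ (2 * k + 1) / w)"
      using assms by (simp add: power_int_minus field_simps del: of_nat_add of_nat_mult of_nat_Suc power_Suc)
  qed
  also have "\<dots> = (\<Prod>k<N. w * r powi (- int (2 * k + 1))) * (\<Prod>k<N. 1 + r ^ (2 * k + 1) / w)"
    by (rule prod.distrib)
  also have "(\<Prod>k<N. w * r powi (- int (2 * k + 1))) = K"
    unfolding K_def
    by (induction N) (simp_all add: algebra_simps flip: power_int_add)
  also have "(\<Prod>k<N. 1 + x * (r\<^sup>2) ^ (N + k)) = (\<Prod>k<N. 1 + w * r ^ (2 * k + 1))"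
  proof (rule prod.cong[OF refl])
    fix k
    have "x * (r\<^sup>2) ^ (N + k) = w * (r powi (1 - 2 * int N) * r powi (int (2 * (N + k))))"
      by (simp only: x_def power_int_of_nat mult.assoc flip: power_mult)
    also have "\<dots> = w * r powi (int (2 * k + 1))"
      by (simp flip: power_int_add)
    finally show "1 + x * (r\<^sup>2) ^ (N + k) = 1 + w * r ^ (2 * k + 1)"
      by (simp only: power_int_of_nat)
  qed
  finally have lhs: "(\<Prod>i<2 * N. 1 + x * (r\<^sup>2) ^ i) = K * ?J"
    by (simp add: prod.distrib mult_ac)
  have "(\<Prod>i<2 * N. 1 + x * (r\<^sup>2) ^ i) =
      (\<Sum>k\<le>2 * N. (r\<^sup>2) ^ (k * (k - 1) div 2) * gaussian_binomial (r\<^sup>2) (2 * N) k * x ^ k)"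
    by (rule q_binomial_theorem)
  also have "\<dots> = (\<Sum>k\<le>2 * N. K * (gaussian_binomial (r\<^sup>2) (2 * N) k *
      (r powi ((int k - int N) * (int k - int N)) * w powi (int k - int N))))"
  proof (rule sum.cong[OF refl])
    fix k :: nat
    have "even (k * (k - 1))" by (cases k) auto
    then have "(r\<^sup>2) ^ (k * (k - 1) div 2) = r ^ (k * (k - 1))"
      by (simp flip: power_mult)
    also have "\<dots> = r powi (int k * int k - int k)"
    proof -
      have "int k * int k - int k = int (k * (k - 1))"
        by (cases k) (auto simp: algebra_simps)
      then show ?thesis by (simp only: power_int_of_nat)
    qed
    finally have 1: "(r\<^sup>2) ^ (k * (k - 1) div 2) = r powi (int k * int k - int k)" .
    have 2: "x ^ k = w powi int k * r powi ((1 - 2 * int N) * int k)"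
      by (simp add: x_def power_mult_distrib power_int_mult)
    \<comment> \<open>Completing the square: k^2 - k + (1 - 2N) k = (k - N)^2 - N^2; the term -N^2
      is absorbed by \<open>K\<close>.\<close>
    have 3: "r powi (int k * int k - int k) * r powi ((1 - 2 * int N) * int k) =
        r powi (- (int N * int N)) * r powi ((int k - int N) * (int k - int N))"
      by (simp add: algebra_simps flip: power_int_add)
    have 4: "w powi int k = w ^ N * w powi (int k - int N)"
      using assms by (simp add: power_int_diff)
    show "(r\<^sup>2) ^ (k * (k - 1) div 2) * gaussian_binomial (r\<^sup>2) (2 * N) k * x ^ k = K * (gaussian_binomial (r\<^sup>2) (2 * N) k *
      (r powi ((int k - int N) * (int k - int N)) * w powi (int k - int N)))"
      using arg_cong[OF 3, of "\<lambda>t. t * gaussian_binomial (r\<^sup>2) (2 * N) k * w powi int k"]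
      unfolding 1 2 K_def 4 by (simp only: mult_ac)
  qed
  also have "\<dots> = K * (\<Sum>k\<le>2 * N. gaussian_binomial (r\<^sup>2) (2 * N) k *
      (r powi ((int k - int N) * (int k - int N)) * w powi (int k - int N)))"
    by (simp add: sum_distrib_left)
  also have "(\<Sum>k\<le>2 * N. gaussian_binomial (r\<^sup>2) (2 * N) k *
      (r powi ((int k - int N) * (int k - int N)) * w powi (int k - int N))) = ?R"
    by (rule sum.reindex_bij_witness[of _ "\<lambda>j. nat (j + int N)" "\<lambda>k. int k - int N"]) auto
  finally show ?thesis
    using lhs \<open>K \<noteq> 0\<close> by simp
qed

text \<open>As N grows, the Gaussian binomials tend to 1/e and stay below 1/e^2, where e is the
  product of all 1 - r^(2i), so Tannery's theorem applies. Only the independence of \<open>C\<close>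
  from \<open>w\<close> is recorded: the relation used later is homogeneous, so the value of
  \<open>C\<close> does not matter.\<close>

lemma triple_product_limit:
  fixes r :: real
  assumes "0 < r" "r < 1"
  obtains C where "\<And>w. w \<noteq> 0 \<Longrightarrow>
    (\<lambda>N. \<Prod>k<N. (1 + w * r ^ (2 * k + 1)) * (1 + r ^ (2 * k + 1) / w)) \<longlonglongrightarrow> C * jtheta r w"
proof -
  define p where "p = r\<^sup>2"
  have p: "0 \<le> p" "p < 1" using assms by (auto simp: p_def power_less_one_iff)
  let ?e = "\<lambda>n. \<Prod>i<n. 1 - p ^ Suc i"
  obtain e where e: "0 < e" "?e \<longlonglongrightarrow> e" "\<And>n. e \<le> ?e n"
    using euler_product_limit[OF p] by metis
  have e1: "?e n \<le> 1" for n
    using p by (intro prod_le_1) (auto simp: power_le_one simp del: power_Suc)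
  have gb: "gaussian_binomial p n k = ?e n / (?e k * ?e (n - k))" if "k \<le> n" for n k
  proof -
    have "?e k * ?e (n - k) \<noteq> 0"
      using e(1) e(3)[of k] e(3)[of "n - k"] by (metis mult_eq_0_iff not_le)
    then show ?thesis
      using gaussian_binomial_prod[OF that, of p] by (simp only: eq_divide_eq mult.assoc if_True not_False_eq_True)
  qed
  have bound: "\<bar>gaussian_binomial p n k\<bar> \<le> 1 / (e * e)" if "k \<le> n" for n k
  proof -
    have "e * e \<le> ?e k * ?e (n - k)"
      using e(1) e(3)[of k] e(3)[of "n - k"] by (intro mult_mono) auto
    then have "?e n / (?e k * ?e (n - k)) \<le> 1 / (e * e)"
      using e1[of n] e(1) by (intro frac_le) auto
    moreover have "0 \<le> ?e n / (?e k * ?e (n - k))"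
      using e(1) e(3)[of k] e(3)[of n] e(3)[of "n - k"] by simp
    ultimately show ?thesis using gb[OF that] by simp
  qed
  have lim: "(\<lambda>N. gaussian_binomial p (2 * N) (nat (j + int N))) \<longlonglongrightarrow> 1 / e" for j
  proof -
    have "filterlim (\<lambda>N. 2 * N) sequentially sequentially"
      by (rule filterlim_subseq) (auto simp: strict_mono_def)
    then have 1: "(\<lambda>N. ?e (2 * N)) \<longlonglongrightarrow> e"
      by (rule filterlim_compose[OF e(2)])
    have shift: "(\<lambda>N. ?e (nat (int N + i))) \<longlonglongrightarrow> e" for i
    proof (rule filterlim_compose[OF e(2)])
      show "filterlim (\<lambda>N. nat (int N + i)) sequentially sequentially"
        unfolding filterlim_at_top
      proof
        fix Z
        show "\<forall>\<^sub>F N in sequentially. Z \<le> nat (int N + i)"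
          using eventually_ge_at_top[of "nat (int Z + \<bar>i\<bar>)"] by eventually_elim auto
      qed
    qed
    have "(\<lambda>N. ?e (2 * N) / (?e (nat (int N + j)) * ?e (nat (int N - j)))) \<longlonglongrightarrow> e / (e * e)"
      using e(1) shift[of j] shift[of "- j"] 1 by (intro tendsto_intros) auto
    moreover have "\<forall>\<^sub>F N in sequentially.
        ?e (2 * N) / (?e (nat (int N + j)) * ?e (nat (int N - j))) = gaussian_binomial p (2 * N) (nat (j + int N))"
      using eventually_ge_at_top[of "nat \<bar>j\<bar>"]
    proof eventually_elim
      case (elim N)
      then have "nat (j + int N) \<le> 2 * N" "2 * N - nat (j + int N) = nat (int N - j)"
        by auto
      then show ?case by (simp add: gb add.commute)
    qed
    ultimately have "(\<lambda>N. gaussian_binomial p (2 * N) (nat (j + int N))) \<longlonglongrightarrow> e / (e * e)"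
      by (rule Lim_transform_eventually)
    then show ?thesis using e(1) by simp
  qed
  have "(\<lambda>N. \<Prod>k<N. (1 + w * r ^ (2 * k + 1)) * (1 + r ^ (2 * k + 1) / w)) \<longlonglongrightarrow> 1 / e * jtheta r w"
    if w: "w \<noteq> 0" for w
  proof -
    let ?t = "\<lambda>j::int. r powi (j * j) * w powi j"
    \<comment> \<open>Extension by 0 outside the range turns the finite sums into sums over all
      integers.\<close>
    define a where "a N j = (if \<bar>j\<bar> \<le> int N then gaussian_binomial p (2 * N) (nat (j + int N)) * ?t j else 0)" for N j
    have "(\<lambda>N. infsum (a N) UNIV) \<longlonglongrightarrow> infsum (\<lambda>j. 1 / e * ?t j) UNIV"
    proof (rule tannery_int)
      show "(\<lambda>j. 1 / (e * e) * norm (?t j)) summable_on UNIV"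
        by (intro summable_on_cmult_right jtheta_abs_summable assms w)
      show "\<bar>a N j\<bar> \<le> 1 / (e * e) * norm (?t j)" for N j
      proof (cases "\<bar>j\<bar> \<le> int N")
        case True
        then have "nat (j + int N) \<le> 2 * N" by auto
        from mult_right_mono[OF bound[OF this], of "norm (?t j)"] True show ?thesis
          by (simp add: a_def abs_mult)
      qed (use e in \<open>auto simp: a_def\<close>)
      show "(\<lambda>N. a N j) \<longlonglongrightarrow> 1 / e * ?t j" for j
      proof (rule Lim_transform_eventually)
        show "(\<lambda>N. gaussian_binomial p (2 * N) (nat (j + int N)) * ?t j) \<longlonglongrightarrow> 1 / e * ?t j"
          by (intro tendsto_mult lim tendsto_const)
        show "\<forall>\<^sub>F N in sequentially. gaussian_binomial p (2 * N) (nat (j + int N)) * ?t j = a N j"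
          using eventually_ge_at_top[of "nat \<bar>j\<bar>"] by eventually_elim (auto simp: a_def)
      qed
    qed
    moreover have "infsum (a N) UNIV = (\<Prod>k<N. (1 + w * r ^ (2 * k + 1)) * (1 + r ^ (2 * k + 1) / w))" for N
    proof -
      have "infsum (a N) UNIV = infsum (a N) {- int N..int N}"
        by (rule infsum_cong_neutral) (auto simp: a_def)
      also have "\<dots> = (\<Sum>j\<in>{- int N..int N}. a N j)" by simp
      also have "\<dots> = (\<Sum>j\<in>{- int N..int N}. gaussian_binomial p (2 * N) (nat (j + int N)) * ?t j)"
        by (intro sum.cong refl) (auto simp: a_def)
      finally show ?thesis
        using finite_triple_product[OF assms(1) w, of N] by (simp add: p_def)
    qed
    ultimately show ?thesis
      by (simp only: jtheta_def infsum_cmult_right')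
  qed
  then show ?thesis by (rule that)
qed

section \<open>The Weierstrass three-term relation\<close>

lemma jtheta_inverse: "jtheta r (1 / w) = jtheta r w"
  unfolding jtheta_def
  by (rule infsum_reindex_bij_witness[of _ uminus uminus])
    (auto simp: power_int_minus power_int_divide_distrib divide_simps)

text \<open>Replacing n by n - 1 and using n^2 = 1 + (n - 1)^2 + 2 (n - 1).\<close>

lemma jtheta_shift:
  assumes "0 < r" "w \<noteq> 0"
  shows "jtheta r w = r * w * jtheta r (r\<^sup>2 * w)"
proof -
  have "jtheta r w = (\<Sum>\<^sub>\<infinity>n::int. r * w * (r powi (n * n) * (r\<^sup>2 * w) powi n))"
    unfolding jtheta_def
  proof (rule infsum_reindex_bij_witness[of _ "\<lambda>n. n + 1" "\<lambda>n. n - 1"])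
    fix n :: int
    have nz: "r \<noteq> 0 \<or> m" for m using assms by simp
    have "(r\<^sup>2) powi (n - 1) = r powi (2 * (n - 1))"
      by (simp only: power_int_mult power_int_numeral)
    moreover have "r * r powi ((n - 1) * (n - 1)) * r powi (2 * (n - 1)) = r powi (n * n)"
    proof -
      have "r powi (1 + (n - 1) * (n - 1) + 2 * (n - 1)) = r * r powi ((n - 1) * (n - 1)) * r powi (2 * (n - 1))"
        by (simp only: power_int_add[OF nz] power_int_1_right)
      then show ?thesis by (simp add: algebra_simps)
    qed
    moreover have "w * w powi (n - 1) = w powi n"
      using assms by (simp add: power_int_diff)
    ultimately show "r * w * (r powi ((n - 1) * (n - 1)) * (r\<^sup>2 * w) powi (n - 1)) = r powi (n * n) * w powi n"
      by (simp add: power_int_mult_distrib mult_ac) (metis mult.assoc mult.left_commute)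
  qed auto
  then show ?thesis
    by (simp add: jtheta_def infsum_cmult_right')
qed

lemma infsum_times:
  fixes f :: "'a \<Rightarrow> real" and g :: "'b \<Rightarrow> real"
  assumes "f abs_summable_on A" "g abs_summable_on B"
  shows "(\<lambda>(x, y). f x * g y) abs_summable_on A \<times> B"
    "infsum (\<lambda>(x, y). f x * g y) (A \<times> B) = infsum f A * infsum g B"
proof -
  show s: "(\<lambda>(x, y). f x * g y) abs_summable_on A \<times> B"
  proof (subst abs_summable_on_Sigma_iff, intro conjI ballI)
    show "(\<lambda>y. norm (case (x, y) of (x, y) \<Rightarrow> f x * g y)) summable_on B" for x
      using assms(2) by (simp add: abs_mult summable_on_cmult_right)
    have "(\<lambda>x. norm (infsum (\<lambda>y. norm (g y)) B) * norm (f x)) summable_on A"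
      by (intro summable_on_cmult_right assms)
    then show "(\<lambda>x. norm (\<Sum>\<^sub>\<infinity>y\<in>B. norm (case (x, y) of (x, y) \<Rightarrow> f x * g y))) summable_on A"
      by (simp add: abs_mult infsum_cmult_right' mult.commute)
  qed
  have "(\<lambda>(x, y). f x * g y) summable_on A \<times> B"
    using s by (rule abs_summable_summable)
  then have "infsum (\<lambda>(x, y). f x * g y) (A \<times> B) = (\<Sum>\<^sub>\<infinity>x\<in>A. \<Sum>\<^sub>\<infinity>y\<in>B. f x * g y)"
    by (simp add: infsum_Sigma'_banach)
  then show "infsum (\<lambda>(x, y). f x * g y) (A \<times> B) = infsum f A * infsum g B"
    by (simp add: infsum_cmult_right' infsum_cmult_left')
qed

text \<open>Pairs (m, n) with even sum are (k + l, k - l), those with odd sum (k + l + 1, k - l).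
  Then m^2 + n^2 is 2k^2 + 2l^2, or that plus 2k + 2l + 1, while \<open>u\<close> carries m + n and
  \<open>v\<close> carries m - n. So the variables separate, with nome r^2.\<close>

lemma jtheta_mult:
  fixes r u v :: real
  assumes "0 < r" "r < 1" "u \<noteq> 0" "v \<noteq> 0"
  shows "jtheta r (u * v) * jtheta r (u / v) =
    jtheta (r\<^sup>2) (u\<^sup>2) * jtheta (r\<^sup>2) (v\<^sup>2) + r * u * v * (jtheta (r\<^sup>2) (r\<^sup>2 * u\<^sup>2) * jtheta (r\<^sup>2) (r\<^sup>2 * v\<^sup>2))"
proof -
  define t where "t R w n = R powi (n * n) * w powi n" for R w :: real and n :: int
  have jtheta: "jtheta R w = infsum (t R w) UNIV" for R w
    unfolding jtheta_def by (rule infsum_cong) (simp add: t_def)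
  have summ: "t R w abs_summable_on UNIV" if "0 < R" "R < 1" "w \<noteq> 0" for R w
    using jtheta_abs_summable[OF that] by (simp add: t_def)
  have R: "0 < r\<^sup>2" "r\<^sup>2 < 1" using assms by (auto simp: power_less_one_iff)
  let ?g = "\<lambda>(m, n). t r (u * v) m * t r (u / v) n"
  define he ho where "he = (\<lambda>(k::int, l). (k + l, k - l))" and "ho = (\<lambda>(k::int, l). (k + l + 1, k - l))"
  have inj: "inj he" "inj ho" by (auto simp: he_def ho_def inj_on_def)
  have un: "UNIV = range he \<union> range ho"
  proof -
    have "(m, n) \<in> range he \<union> range ho" for m n :: int
    proof (cases "even (m + n)")
      case True
      then obtain k where "m + n = 2 * k" by blast
      then have "(m, n) = he (k, m - k)" by (simp add: he_def)
      then show ?thesis by blast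
    next
      case False
      then obtain k where "m + n = 2 * k + 1" by (elim oddE)
      then have "(m, n) = ho (k, m - k - 1)" by (simp add: ho_def)
      then show ?thesis by blast
    qed
    then show ?thesis by auto
  qed
  have disj: "range he \<inter> range ho = {}"
  proof -
    have "he x \<noteq> ho y" for x y
    proof
      assume "he x = ho y"
      then have "fst (he x) + snd (he x) = fst (ho y) + snd (ho y)" by simp
      then have "2 * fst x = 2 * fst y + 1" by (simp add: he_def ho_def split: prod.splits)
      then show False by presburger
    qed
    then show ?thesis by blast
  qed
  have "u * v \<noteq> 0" "u / v \<noteq> 0" using assms by auto
  note P = infsum_times[OF summ[OF assms(1,2) this(1)] summ[OF assms(1,2) this(2)]]
  have S: "?g summable_on X" for X
    by (rule summable_on_subset[OF abs_summable_summable]) (use P in auto)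
  have r2: "(r\<^sup>2) powi n = r powi (2 * n)" for n by (simp add: power_int_mult)
  have sq: "(x\<^sup>2) powi n = x powi (2 * n)" for x :: real and n by (simp add: power_int_mult)
  have nz: "r \<noteq> 0" "u \<noteq> 0" "v \<noteq> 0" using assms by auto
  have E: "?g \<circ> he = (\<lambda>(k, l). t (r\<^sup>2) (u\<^sup>2) k * t (r\<^sup>2) (v\<^sup>2) l)"
  proof
    fix z :: "int \<times> int"
    obtain k l where z: "z = (k, l)" by force
    have 1: "r powi ((k+l)*(k+l)) * r powi ((k-l)*(k-l)) = r powi (2*(k*k)) * r powi (2*(l*l))"
      using nz by (simp add: algebra_simps flip: power_int_add)
    have 2: "(u * v) powi (k+l) * (u / v) powi (k-l) = u powi (2*k) * v powi (2*l)"
    proof -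
      have "(u * v) powi (k+l) * (u / v) powi (k-l) = (u powi (k+l) * u powi (k-l)) * (v powi (k+l) / v powi (k-l))"
        by (simp add: power_int_mult_distrib power_int_divide_distrib)
      also have "u powi (k+l) * u powi (k-l) = u powi (2*k)" using nz by (simp flip: power_int_add)
      also have "v powi (k+l) / v powi (k-l) = v powi (2*l)" using nz by (simp flip: power_int_diff)
      finally show ?thesis .
    qed
    have "(?g \<circ> he) z = (r powi ((k+l)*(k+l)) * r powi ((k-l)*(k-l))) * ((u * v) powi (k+l) * (u / v) powi (k-l))"
      by (simp add: z he_def t_def mult_ac)
    also have "\<dots> = (\<lambda>(k, l). t (r\<^sup>2) (u\<^sup>2) k * t (r\<^sup>2) (v\<^sup>2) l) z"
      unfolding 1 2 by (simp only: z t_def r2 sq prod.case mult_ac)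
    finally show "(?g \<circ> he) z = (\<lambda>(k, l). t (r\<^sup>2) (u\<^sup>2) k * t (r\<^sup>2) (v\<^sup>2) l) z" .
  qed
  have O: "?g \<circ> ho = (\<lambda>z. r * u * v * (\<lambda>(k, l). t (r\<^sup>2) (r\<^sup>2 * u\<^sup>2) k * t (r\<^sup>2) (r\<^sup>2 * v\<^sup>2) l) z)"
  proof
    fix z :: "int \<times> int"
    obtain k l where z: "z = (k, l)" by force
    have 1: "r powi ((k+l+1)*(k+l+1)) * r powi ((k-l)*(k-l)) =
        r * r powi (2*(k*k)) * r powi (2*k) * r powi (2*(l*l)) * r powi (2*l)"
    proof -
      have "r * r powi (2*(k*k)) * r powi (2*k) * r powi (2*(l*l)) * r powi (2*l) =
          r powi (1 + 2*(k*k) + 2*k + 2*(l*l) + 2*l)"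
        by (simp only: power_int_add[OF disjI1[OF nz(1)]] power_int_1_right)
      then show ?thesis using nz by (simp add: algebra_simps flip: power_int_add)
    qed
    have 2: "(u * v) powi (k+l+1) * (u / v) powi (k-l) = u * v * u powi (2*k) * v powi (2*l)"
    proof -
      have "(u * v) powi (k+l+1) * (u / v) powi (k-l) = (u powi (k+l+1) * u powi (k-l)) * (v powi (k+l+1) / v powi (k-l))"
        by (simp add: power_int_mult_distrib power_int_divide_distrib)
      also have "u powi (k+l+1) * u powi (k-l) = u powi (2*k+1)" using nz by (simp add: algebra_simps flip: power_int_add)
      also have "v powi (k+l+1) / v powi (k-l) = v powi (2*l+1)" using nz by (simp add: algebra_simps flip: power_int_diff)
      also have "u powi (2*k+1) * v powi (2*l+1) = u * v * u powi (2*k) * v powi (2*l)"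
        using nz by (simp add: power_int_add)
      finally show ?thesis .
    qed
    have "(?g \<circ> ho) z = (r powi ((k+l+1)*(k+l+1)) * r powi ((k-l)*(k-l))) * ((u * v) powi (k+l+1) * (u / v) powi (k-l))"
      by (simp add: z ho_def t_def mult_ac)
    also have "\<dots> = r * u * v * (\<lambda>(k, l). t (r\<^sup>2) (r\<^sup>2 * u\<^sup>2) k * t (r\<^sup>2) (r\<^sup>2 * v\<^sup>2) l) z"
      unfolding 1 2 by (simp only: z t_def r2 sq prod.case mult_ac power_int_mult_distrib)
    finally show "(?g \<circ> ho) z = r * u * v * (\<lambda>(k, l). t (r\<^sup>2) (r\<^sup>2 * u\<^sup>2) k * t (r\<^sup>2) (r\<^sup>2 * v\<^sup>2) l) z" .
  qed
  have nz2: "u\<^sup>2 \<noteq> 0" "v\<^sup>2 \<noteq> 0" "r\<^sup>2 * u\<^sup>2 \<noteq> 0" "r\<^sup>2 * v\<^sup>2 \<noteq> 0" using nz by auto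
  have "jtheta r (u * v) * jtheta r (u / v) = infsum ?g (range he \<union> range ho)"
    using P(2) un by (simp add: jtheta)
  also have "\<dots> = infsum ?g (range he) + infsum ?g (range ho)"
    by (rule infsum_Un_disjoint[OF S S disj])
  also have "infsum ?g (range he) = jtheta (r\<^sup>2) (u\<^sup>2) * jtheta (r\<^sup>2) (v\<^sup>2)"
    unfolding infsum_reindex[OF inj(1)] E
    using infsum_times(2)[OF summ[OF R nz2(1)] summ[OF R nz2(2)]] by (simp add: jtheta)
  also have "infsum ?g (range ho) = r * u * v * (jtheta (r\<^sup>2) (r\<^sup>2 * u\<^sup>2) * jtheta (r\<^sup>2) (r\<^sup>2 * v\<^sup>2))"
    unfolding infsum_reindex[OF inj(2)] O infsum_cmult_right'
    using infsum_times(2)[OF summ[OF R nz2(3)] summ[OF R nz2(4)]] by (simp add: jtheta)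
  finally show ?thesis .
qed

text \<open>This is \<open>jtheta_mult\<close> at u = x/r, v = -y: the sign of \<open>v\<close>
  makes the sum a difference, and the shift relation removes the division by \<open>r\<close>. The
  right side is x times a determinant with one row depending on x and the other on y.\<close>

lemma theta_mult:
  fixes r x y :: real
  assumes "0 < r" "r < 1" "x \<noteq> 0" "y \<noteq> 0"
  shows "jtheta r (- (x * y) / r) * jtheta r (- (x / y) / r) =
    x * (x * jtheta (r\<^sup>2) (r\<^sup>2 * x\<^sup>2) * jtheta (r\<^sup>2) (y\<^sup>2) - jtheta (r\<^sup>2) (x\<^sup>2) * (y * jtheta (r\<^sup>2) (r\<^sup>2 * y\<^sup>2)))"
proof -
  have "jtheta (r\<^sup>2) ((x / r)\<^sup>2) = x\<^sup>2 * jtheta (r\<^sup>2) (r\<^sup>2 * x\<^sup>2)"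
    using jtheta_shift[of "r\<^sup>2" "(x / r)\<^sup>2"] assms by (simp add: power_divide field_simps power2_eq_square)
  moreover have "r\<^sup>2 * (x / r)\<^sup>2 = x\<^sup>2"
    using assms by (simp add: power_divide)
  moreover have "x / r * - y = - (x * y) / r" "x / r / - y = - (x / y) / r"
    by auto
  ultimately show ?thesis
    using jtheta_mult[of r "x / r" "- y"] assms by (simp add: algebra_simps power2_eq_square)
qed

text \<open>By \<open>theta_mult\<close> each \<open>T (x * y) * T (x / y)\<close> is \<open>x\<close> times a 2-by-2 minor, so this is
  the Pluecker relation for four vectors in the plane.\<close>

lemma theta_three_term:
  fixes r x y u v :: real
  defines "T \<equiv> \<lambda>z. jtheta r (- z / r)"
  assumes "0 < r" "r < 1" "x \<noteq> 0" "y \<noteq> 0" "u \<noteq> 0" "v \<noteq> 0"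
  shows "y * (T (x * y) * T (x / y) * (T (u * v) * T (u / v)))
    - u * (T (x * u) * T (x / u) * (T (y * v) * T (y / v)))
    + u * (T (x * v) * T (x / v) * (T (y * u) * T (y / u))) = 0"
proof -
  note m = theta_mult[OF assms(2,3)]
  show ?thesis
    unfolding T_def m[OF assms(4,5)] m[OF assms(6,7)] m[OF assms(4,6)] m[OF assms(5,7)]
      m[OF assms(4,7)] m[OF assms(5,6)]
    by algebra
qed

text \<open>Substituting w = -z/r makes the odd exponents even. \<open>T\<close> is the theta
  function without its Euler factor; as every term of the three-term relation has four theta values,
  the constant \<open>C\<close> factors out.\<close>

lemma theta_product:
  fixes r :: real
  assumes r: "0 < r" "r < 1"
  obtains T where
    "\<And>z. z \<noteq> 0 \<Longrightarrow> (\<lambda>N. \<Prod>k<N. (1 - z * r ^ (2 * k)) * (1 - r ^ (2 * k + 2) / z)) \<longlonglongrightarrow> T z"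
    "\<And>z. z \<noteq> 0 \<Longrightarrow> T (1 / z) = - T z / z"
    "\<And>z. z \<noteq> 0 \<Longrightarrow> T (r\<^sup>2 / z) = T z"
    "\<And>x y u v. x \<noteq> 0 \<Longrightarrow> y \<noteq> 0 \<Longrightarrow> u \<noteq> 0 \<Longrightarrow> v \<noteq> 0 \<Longrightarrow>
      y * (T (x * y) * T (x / y) * (T (u * v) * T (u / v)))
      - u * (T (x * u) * T (x / u) * (T (y * v) * T (y / v)))
      + u * (T (x * v) * T (x / v) * (T (y * u) * T (y / u))) = 0"
proof -
  obtain C where C: "\<And>w. w \<noteq> 0 \<Longrightarrow>
    (\<lambda>N. \<Prod>k<N. (1 + w * r ^ (2 * k + 1)) * (1 + r ^ (2 * k + 1) / w)) \<longlonglongrightarrow> C * jtheta r w"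
    using triple_product_limit[OF r] by blast
  define S where "S z = jtheta r (- z / r)" for z
  define T where "T z = C * S z" for z
  show ?thesis
  proof (rule that[of T])
    fix z :: real assume z: "z \<noteq> 0"
    have "(1 + - z / r * r ^ (2 * k + 1)) * (1 + r ^ (2 * k + 1) / (- z / r))
        = (1 - z * r ^ (2 * k)) * (1 - r ^ (2 * k + 2) / z)" for k
      using r z by simp
    then show "(\<lambda>N. \<Prod>k<N. (1 - z * r ^ (2 * k)) * (1 - r ^ (2 * k + 2) / z)) \<longlonglongrightarrow> T z"
      using C[of "- z / r"] r z by (simp only: T_def S_def) simp
    have "jtheta r (- (1 / z) / r) = jtheta r (- (r * z))"
      using jtheta_inverse[of r "- (r * z)"] by (simp add: mult.commute)
    moreover have "jtheta r (- z / r) = - z * jtheta r (- (r * z))"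
      using jtheta_shift[of r "- z / r"] r z by (simp add: power2_eq_square)
    ultimately show "T (1 / z) = - T z / z"
      using z by (simp add: T_def S_def)
    have "- (r\<^sup>2 / z) / r = 1 / (- z / r)"
      using r by (simp add: power2_eq_square)
    then show "T (r\<^sup>2 / z) = T z"
      using jtheta_inverse[of r "- z / r"] by (simp only: T_def S_def)
  next
    fix x y u v :: real
    assume "x \<noteq> 0" "y \<noteq> 0" "u \<noteq> 0" "v \<noteq> 0"
    then have "y * (S (x * y) * S (x / y) * (S (u * v) * S (u / v)))
      - u * (S (x * u) * S (x / u) * (S (y * v) * S (y / v)))
      + u * (S (x * v) * S (x / v) * (S (y * u) * S (y / u))) = 0"
      unfolding S_def by (rule theta_three_term[OF r])
    then show "y * (T (x * y) * T (x / y) * (T (u * v) * T (u / v)))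
      - u * (T (x * u) * T (x / u) * (T (y * v) * T (y / v)))
      + u * (T (x * v) * T (x / v) * (T (y * u) * T (y / u))) = 0"
      unfolding T_def by algebra
  qed
qed

section \<open>Products over residue classes\<close>

text \<open>The residues a and -a modulo \<open>M\<close>, cut off after \<open>N\<close> full
  blocks of length \<open>M\<close>.\<close>

definition tprod :: "real \<Rightarrow> nat \<Rightarrow> nat \<Rightarrow> nat \<Rightarrow> real" where
  "tprod q M a N = (\<Prod>k<N. (1 - q ^ (M * k + a)) * (1 - q ^ (M * k + (M - a))))"

lemma pm_residues_block:
  assumes "\<And>r. r \<in> R \<Longrightarrow> 0 < r \<and> 2 * r < M"
  shows "pm_residues (int ` R) (int M) \<inter> {M * k..<M * k + M} =
    (\<lambda>r. M * k + r) ` R \<union> (\<lambda>r. M * k + (M - r)) ` R"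
proof (intro equalityI subsetI)
  fix n assume n: "n \<in> pm_residues (int ` R) (int M) \<inter> {M * k..<M * k + M}"
  then obtain r where r: "r \<in> R" and c: "[int n = int r] (mod int M) \<or> [int n = - int r] (mod int M)"
    by (auto simp: pm_residues_def)
  define j where "j = n - M * k"
  have j: "n = M * k + j" "j < M" using n by (auto simp: j_def)
  have rM: "0 < r" "2 * r < M" using assms r by auto
  have "[int n = int j] (mod int M)"
    by (simp add: j cong_def)
  moreover have "[- int r = int (M - r)] (mod int M)"
    using rM by (simp add: of_nat_diff cong_def)
  ultimately have "[int j = int r] (mod int M) \<or> [int j = int (M - r)] (mod int M)"
    using c by (metis cong_sym cong_trans)
  then have "j = r \<or> j = M - r"
    using j(2) rM unfolding cong_int_iff by (auto simp: cong_def)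
  then show "n \<in> (\<lambda>r. M * k + r) ` R \<union> (\<lambda>r. M * k + (M - r)) ` R"
    using r j by blast
next
  fix n assume "n \<in> (\<lambda>r. M * k + r) ` R \<union> (\<lambda>r. M * k + (M - r)) ` R"
  then obtain r where r: "r \<in> R" and n: "n = M * k + r \<or> n = M * k + (M - r)" by blast
  have rM: "0 < r" "2 * r < M" using assms r by auto
  have "[int n = int r] (mod int M) \<or> [int n = - int r] (mod int M)"
    using n
  proof
    assume "n = M * k + (M - r)"
    then have "int n = - int r + int M * (int k + 1)"
      using rM by (simp add: of_nat_diff algebra_simps)
    then show ?thesis by (simp only: cong_def mod_mult_self2 simp_thms)
  qed (simp add: cong_def)
  moreover have "0 < n" "M * k \<le> n" "n < M * k + M" using n rM by auto
  ultimately show "n \<in> pm_residues (int ` R) (int M) \<inter> {M * k..<M * k + M}"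
    using r by (auto simp: pm_residues_def)
qed

text \<open>In each block the class of -r is represented by M - r. Since all \<open>r\<close> lie
  below M/2, the two families are disjoint and no factor is counted twice.\<close>

lemma prod_pm_residues:
  fixes q :: real
  assumes "finite R" and R: "\<And>r. r \<in> R \<Longrightarrow> 0 < r \<and> 2 * r < M"
  shows "(\<Prod>s\<in>pm_residues (int ` R) (int M) \<inter> {..<M * N}. 1 - q ^ s) = (\<Prod>r\<in>R. tprod q M r N)"
proof -
  let ?S = "pm_residues (int ` R) (int M)"
  have block: "(\<Prod>s\<in>?S \<inter> {M * k..<M * k + M}. 1 - q ^ s) =
      (\<Prod>r\<in>R. (1 - q ^ (M * k + r)) * (1 - q ^ (M * k + (M - r))))" for k
  proof -
    let ?A = "(\<lambda>r. M * k + r) ` R" and ?B = "(\<lambda>r. M * k + (M - r)) ` R"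
    have "M * k + a \<noteq> M * k + (M - b)" if "a \<in> R" "b \<in> R" for a b
      using R[OF that(1)] R[OF that(2)] by linarith
    then have disj: "?A \<inter> ?B = {}" by blast
    have inj1: "inj_on (\<lambda>r. M * k + r) R"
      by (simp add: inj_on_def)
    have inj2: "inj_on (\<lambda>r. M * k + (M - r)) R"
    proof (rule inj_onI)
      fix a b assume "a \<in> R" "b \<in> R" "M * k + (M - a) = M * k + (M - b)"
      then show "a = b" using R[of a] R[of b] by linarith
    qed
    have un: "?S \<inter> {M * k..<M * k + M} = ?A \<union> ?B"
      by (rule pm_residues_block) (rule R)
    have "(\<Prod>s\<in>?S \<inter> {M * k..<M * k + M}. 1 - q ^ s) = (\<Prod>s\<in>?A. 1 - q ^ s) * (\<Prod>s\<in>?B. 1 - q ^ s)"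
      unfolding un by (intro prod.union_disjoint finite_imageI assms(1) disj)
    also have "\<dots> = (\<Prod>r\<in>R. 1 - q ^ (M * k + r)) * (\<Prod>r\<in>R. 1 - q ^ (M * k + (M - r)))"
      by (simp only: prod.reindex[OF inj1] prod.reindex[OF inj2] o_def)
    finally show ?thesis by (simp only: prod.distrib)
  qed
  have "(\<Prod>s\<in>?S \<inter> {..<M * N}. 1 - q ^ s) =
      (\<Prod>k<N. \<Prod>r\<in>R. (1 - q ^ (M * k + r)) * (1 - q ^ (M * k + (M - r))))"
  proof (induction N)
    case (Suc N)
    have un: "?S \<inter> {..<M * Suc N} = (?S \<inter> {..<M * N}) \<union> (?S \<inter> {M * N..<M * N + M})"
      by auto
    have "(\<Prod>s\<in>?S \<inter> {..<M * Suc N}. 1 - q ^ s) =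
        (\<Prod>s\<in>?S \<inter> {..<M * N}. 1 - q ^ s) * (\<Prod>s\<in>?S \<inter> {M * N..<M * N + M}. 1 - q ^ s)"
      unfolding un by (rule prod.union_disjoint) auto
    then show ?case by (simp only: Suc.IH block prod.lessThan_Suc)
  qed auto
  also have "\<dots> = (\<Prod>r\<in>R. tprod q M r N)"
    unfolding tprod_def by (rule prod.swap)
  finally show ?thesis .
qed

text \<open>One block of length 2M is two blocks of length M: its members a, M - a, M + a, 2M - a
  regroup into the residues a and -a modulo M.\<close>

lemma tprod_split:
  assumes "a \<le> M"
  shows "tprod q (2 * M) a N * tprod q (2 * M) (M - a) N = tprod q M a (2 * N)"
proof (induction N)
  case (Suc N)
  have d: "2 * M - (M - a) = M + a" "2 * M - a = M + (M - a)" using assms by auto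
  have s: "tprod q L b (Suc n) = tprod q L b n * ((1 - q ^ (L * n + b)) * (1 - q ^ (L * n + (L - b))))" for L b n
    by (simp add: tprod_def)
  have e: "2 * Suc N = Suc (Suc (2 * N))" by simp
  have i: "M * (2 * N) + b = 2 * M * N + b" "M * Suc (2 * N) + b = 2 * M * N + (M + b)" for b
    by (simp_all add: algebra_simps)
  show ?case
    unfolding e s Suc.IH[symmetric] d i by (simp only: mult_ac)
qed (simp add: tprod_def)

lemma tprod_double:
  fixes q :: real
  assumes "a \<le> M" "q \<noteq> 0"
  shows "tprod q (2 * M) (2 * a) N =
    (\<Prod>k<N. (1 - q ^ a * q ^ (M * k)) * (1 - q ^ (M * k + M) / q ^ a)) *
    (\<Prod>k<N. (1 - - (q ^ a) * q ^ (M * k)) * (1 - q ^ (M * k + M) / - (q ^ a)))"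
proof -
  have f: "1 - q ^ (2 * n) = (1 - q ^ n) * (1 + q ^ n)" for n
    by (simp add: power_mult algebra_simps power2_eq_square power_mult_distrib flip: power_mult power_add mult_2)
  have d: "q ^ (M * k + M) / q ^ a = q ^ (M * k + (M - a))" for k
    using assms by (simp add: power_diff power_add)
  have g: "2 * M * k + 2 * a = 2 * (M * k + a)" "2 * M * k + (2 * M - 2 * a) = 2 * (M * k + (M - a))" for k
    by (simp_all add: algebra_simps diff_mult_distrib2)
  show ?thesis
    unfolding tprod_def prod.distrib[symmetric] g f
    by (intro prod.cong refl) (simp add: d, simp add: power_add mult_ac)
qed

text \<open>Here \<open>b a\<close> and \<open>m a\<close> are the limits of the products of \<open>(1 - z q^(24k)) (1 - q^(24k+24) / z)\<close>
  at \<open>z = q^a\<close> and \<open>z = -q^a\<close>.\<close>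

lemma tprod_limits:
  fixes q :: real
  assumes q: "q \<noteq> 0" "\<bar>q\<bar> < 1"
  obtains b m :: "nat \<Rightarrow> real" where
    "\<And>a. a \<le> 24 \<Longrightarrow> (\<lambda>N. tprod q 48 a N * tprod q 48 (24 - a) N) \<longlonglongrightarrow> b a"
    "\<And>a. a \<le> 24 \<Longrightarrow> tprod q 48 (2 * a) \<longlonglongrightarrow> b a * m a"
    "m 9 * m 7 * m 5 * m 1 - q * (m 11 * m 5 * m 3 * m 1) = b 10 * b 6 * b 4 * b 2"
    "m 11 * m 9 * m 7 * m 1 - m 11 * m 7 * m 5 * m 3 = q * (b 10 * b 6 * b 4 * b 2)"
proof -
  \<comment> \<open>An even power of \<open>q\<close> keeps the nome positive for negative
    \<open>q\<close>, and r^2 = q^24 is the required period.\<close>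
  define r where "r = q ^ 12"
  have r_abs: "r = \<bar>q\<bar> ^ 12" by (simp add: r_def power_even_abs)
  have r: "0 < r" "r < 1"
    unfolding r_abs using q by (simp, subst power_less_one_iff, auto)
  have rk: "r ^ (2 * k) = q ^ (24 * k)" for k
    by (simp add: r_def flip: power_mult)
  have r2: "r\<^sup>2 = q ^ 24" and rk2: "r ^ (2 * k + 2) = q ^ (24 * k + 24)" for k
    using rk[of 1] rk[of "k + 1"] by (simp_all add: add.commute power2_eq_square)
  show ?thesis
  proof (rule theta_product[OF r, unfolded rk2 rk r2])
    fix T
    assume
      T: "\<And>z. z \<noteq> 0 \<Longrightarrow> (\<lambda>N. \<Prod>k<N. (1 - z * q ^ (24 * k)) * (1 - q ^ (24 * k + 24) / z)) \<longlonglongrightarrow> T z"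
      and inv: "\<And>z. z \<noteq> 0 \<Longrightarrow> T (1 / z) = - T z / z"
      and refl: "\<And>z. z \<noteq> 0 \<Longrightarrow> T (q ^ 24 / z) = T z"
      and three: "\<And>x y u v. x \<noteq> 0 \<Longrightarrow> y \<noteq> 0 \<Longrightarrow> u \<noteq> 0 \<Longrightarrow> v \<noteq> 0 \<Longrightarrow>
        y * (T (x * y) * T (x / y) * (T (u * v) * T (u / v)))
        - u * (T (x * u) * T (x / u) * (T (y * v) * T (y / v)))
        + u * (T (x * v) * T (x / v) * (T (y * u) * T (y / u))) = 0"
    show ?thesis
    proof (rule that[of "\<lambda>a. T (q ^ a)" "\<lambda>a. T (- (q ^ a))"])
      fix a :: nat assume a: "a \<le> 24"
      have "tprod q 24 a = (\<lambda>N. \<Prod>k<N. (1 - q ^ a * q ^ (24 * k)) * (1 - q ^ (24 * k + 24) / q ^ a))"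
        using a q by (auto simp: tprod_def power_add power_diff mult_ac intro!: prod.cong)
      then have "tprod q 24 a \<longlonglongrightarrow> T (q ^ a)"
        using T[of "q ^ a"] q by simp
      then have "(\<lambda>N. tprod q 24 a (2 * N)) \<longlonglongrightarrow> T (q ^ a)"
        by (rule filterlim_compose) (rule filterlim_subseq, auto simp: strict_mono_def)
      then show "(\<lambda>N. tprod q 48 a N * tprod q 48 (24 - a) N) \<longlonglongrightarrow> T (q ^ a)"
        using tprod_split[OF a, of q] by simp
      have "tprod q 48 (2 * a) = (\<lambda>N. (\<Prod>k<N. (1 - q ^ a * q ^ (24 * k)) * (1 - q ^ (24 * k + 24) / q ^ a)) *
          (\<Prod>k<N. (1 - - (q ^ a) * q ^ (24 * k)) * (1 - q ^ (24 * k + 24) / - (q ^ a))))"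
        using tprod_double[OF a q(1)] by (intro ext) simp
      then show "tprod q 48 (2 * a) \<longlonglongrightarrow> T (q ^ a) * T (- (q ^ a))"
        using tendsto_mult[OF T[of "q ^ a"] T[of "- (q ^ a)"]] q by simp
    next
      \<comment> \<open>the three-term relation at \<open>(x, y, u, v) = (q^8, -q, -q^3, q^2)\<close>\<close>
      have e: "q^8 * - q = - (q^9)" "q^8 / - q = - (q^7)" "- (q^3) * q^2 = - (q^5)" "- (q^3) / q^2 = - (q^1)"
        "q^8 * - (q^3) = - (q^11)" "q^8 / - (q^3) = - (q^5)" "- q * q^2 = - (q^3)" "- q / q^2 = 1 / - (q^1)"
        "q^8 * q^2 = q^10" "q^8 / q^2 = q^6" "- q * - (q^3) = q^4" "- q / - (q^3) = 1 / q^2"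
        using q by (simp_all add: field_simps flip: power_add power_Suc power_Suc2) (simp_all only: power2_eq_square)
      \<comment> \<open>Inversion removes the negative exponents.\<close>
      have i: "T (1 / - (q^1)) = T (- (q^1)) / q" "T (1 / q^2) = - T (q^2) / q^2"
        using inv[of "- q"] inv[of "q^2"] q by auto
      have "- q * (T (- (q^9)) * T (- (q^7)) * (T (- (q^5)) * T (- (q^1))))
        - - (q^3) * (T (- (q^11)) * T (- (q^5)) * (T (- (q^3)) * (T (- (q^1)) / q)))
        + - (q^3) * (T (q^10) * T (q^6) * (T (q^4) * (- T (q^2) / q^2))) = 0"
        using three[of "q^8" "- q" "- (q^3)" "q^2"] q unfolding e i by simp
      \<comment> \<open>The common factor -q is pulled out, to be cancelled next.\<close>
      then have "- q * (T (- (q^9)) * T (- (q^7)) * T (- (q^5)) * T (- (q^1)) -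
          q * (T (- (q^11)) * T (- (q^5)) * T (- (q^3)) * T (- (q^1))) -
          T (q^10) * T (q^6) * T (q^4) * T (q^2)) = 0"
        using q by (simp add: field_simps power2_eq_square power3_eq_cube)
      then show "T (- (q^9)) * T (- (q^7)) * T (- (q^5)) * T (- (q^1)) -
          q * (T (- (q^11)) * T (- (q^5)) * T (- (q^3)) * T (- (q^1))) =
          T (q^10) * T (q^6) * T (q^4) * T (q^2)"
        using q by simp
    next
      \<comment> \<open>the three-term relation at \<open>(x, y, u, v) = (q^10, -q, q^4, -q^3)\<close>\<close>
      have e: "q^10 * - q = - (q^11)" "q^10 / - q = - (q^9)" "q^4 * - (q^3) = - (q^7)" "q^4 / - (q^3) = - (q^1)"
        "q^10 * q^4 = q^24 / q^10" "q^10 / q^4 = q^6" "- q * - (q^3) = q^4" "- q / - (q^3) = 1 / q^2"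
        "q^10 * - (q^3) = q^24 / - (q^11)" "q^10 / - (q^3) = - (q^7)" "- q * q^4 = - (q^5)" "- q / q^4 = 1 / - (q^3)"
        using q by (simp_all add: field_simps flip: power_add power_Suc power_Suc2)
      \<comment> \<open>The exponents 14 and 13 reflect to 10 and 11; inversion handles the negative
        ones.\<close>
      have i: "T (q^24 / q^10) = T (q^10)" "T (q^24 / - (q^11)) = T (- (q^11))"
        "T (1 / q^2) = - T (q^2) / q^2" "T (1 / - (q^3)) = T (- (q^3)) / q^3"
        using refl[of "q^10"] refl[of "- (q^11)"] inv[of "q^2"] inv[of "- (q^3)"] q by auto
      have "- q * (T (- (q^11)) * T (- (q^9)) * (T (- (q^7)) * T (- (q^1))))
        - q^4 * (T (q^10) * T (q^6) * (T (q^4) * (- T (q^2) / q^2)))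
        + q^4 * (T (- (q^11)) * T (- (q^7)) * (T (- (q^5)) * (T (- (q^3)) / q^3))) = 0"
        using three[of "q^10" "- q" "q^4" "- (q^3)"] q unfolding e i by simp
      then have "- q * (T (- (q^11)) * T (- (q^9)) * T (- (q^7)) * T (- (q^1)) -
          T (- (q^11)) * T (- (q^7)) * T (- (q^5)) * T (- (q^3)) -
          q * (T (q^10) * T (q^6) * T (q^4) * T (q^2))) = 0"
        using q by (simp add: field_simps power2_eq_square power3_eq_cube power4_eq_xxxx)
      then show "T (- (q^11)) * T (- (q^9)) * T (- (q^7)) * T (- (q^1)) -
          T (- (q^11)) * T (- (q^7)) * T (- (q^5)) * T (- (q^3)) =
          q * (T (q^10) * T (q^6) * T (q^4) * T (q^2))"
        using q by simp
    qed
  qed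
qed

section \<open>Generating functions of the residue sets\<close>

lemma pm_residues_gf:
  fixes q :: real
  assumes "\<bar>q\<bar> < 1" "finite R" "\<forall>r\<in>R. 0 < r \<and> 2 * r < M" "0 < M"
    and "(\<lambda>N. \<Prod>r\<in>R. tprod q M r N) \<longlonglongrightarrow> L"
  shows "L \<noteq> 0" "(\<lambda>n. num_partitions (pm_residues (int ` R) (int M)) n * q ^ n) sums (1 / L)"
proof -
  have "(\<lambda>N. \<Prod>s\<in>pm_residues (int ` R) (int M) \<inter> {..<M * N}. 1 - q ^ s) \<longlonglongrightarrow> L"
    by (subst prod_pm_residues) (use assms in blast)+
  moreover have "strict_mono (\<lambda>N. M * N)"
    using assms(4) by (simp add: strict_mono_def)
  ultimately show "L \<noteq> 0" "(\<lambda>n. num_partitions (pm_residues (int ` R) (int M)) n * q ^ n) sums (1 / L)"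
    using partitions_gf[OF zero_notin_pm_residues assms(1)] by blast+
qed

text \<open>The right-hand sides record the exceptions: 1 is the constant term of the first series
  in (i), and \<open>q\<close> is the single partition of 1 in (ii), where 1 belongs to T but not to
  S.\<close>

lemma gf_identities:
  fixes q :: real
  assumes q: "q \<noteq> 0" "\<bar>q\<bar> < 1"
  defines "F \<equiv> \<lambda>R n. num_partitions (pm_residues R 48) n * q ^ n"
  shows "\<exists>s t. F {1, 4, 5, 6, 7, 9, 15, 17, 19, 20, 22, 23} sums s \<and>
      F {1, 3, 4, 5, 11, 13, 14, 18, 19, 20, 21, 23} sums t \<and> s - q * t = 1"
    and "\<exists>s t. F {2, 3, 4, 5, 7, 11, 13, 17, 18, 19, 20, 21} sums s \<and>
      F {1, 4, 6, 7, 9, 10, 11, 13, 15, 17, 20, 23} sums t \<and> t - s = q"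
proof -
  obtain b m where
    pair: "\<And>a. a \<le> 24 \<Longrightarrow> (\<lambda>N. tprod q 48 a N * tprod q 48 (24 - a) N) \<longlonglongrightarrow> b a"
    and dbl: "\<And>a. a \<le> 24 \<Longrightarrow> tprod q 48 (2 * a) \<longlonglongrightarrow> b a * m a"
    and id1: "m 9 * m 7 * m 5 * m 1 - q * (m 11 * m 5 * m 3 * m 1) = b 10 * b 6 * b 4 * b 2"
    and id2: "m 11 * m 9 * m 7 * m 1 - m 11 * m 7 * m 5 * m 3 = q * (b 10 * b 6 * b 4 * b 2)"
    using tprod_limits[OF q] by blast
  let ?t = "\<lambda>a N. tprod q 48 a N"
  have p: "(\<lambda>N. ?t 1 N * ?t 23 N) \<longlonglongrightarrow> b 1" "(\<lambda>N. ?t 2 N * ?t 22 N) \<longlonglongrightarrow> b 2"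
    "(\<lambda>N. ?t 3 N * ?t 21 N) \<longlonglongrightarrow> b 3" "(\<lambda>N. ?t 4 N * ?t 20 N) \<longlonglongrightarrow> b 4"
    "(\<lambda>N. ?t 5 N * ?t 19 N) \<longlonglongrightarrow> b 5" "(\<lambda>N. ?t 6 N * ?t 18 N) \<longlonglongrightarrow> b 6"
    "(\<lambda>N. ?t 7 N * ?t 17 N) \<longlonglongrightarrow> b 7" "(\<lambda>N. ?t 9 N * ?t 15 N) \<longlonglongrightarrow> b 9"
    "(\<lambda>N. ?t 10 N * ?t 14 N) \<longlonglongrightarrow> b 10" "(\<lambda>N. ?t 11 N * ?t 13 N) \<longlonglongrightarrow> b 11"
    using pair[of 1] pair[of 2] pair[of 3] pair[of 4] pair[of 5] pair[of 6] pair[of 7] pair[of 9]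
      pair[of 10] pair[of 11] by simp_all
  have d: "?t 2 \<longlonglongrightarrow> b 1 * m 1" "?t 6 \<longlonglongrightarrow> b 3 * m 3" "?t 10 \<longlonglongrightarrow> b 5 * m 5"
    "?t 14 \<longlonglongrightarrow> b 7 * m 7" "?t 18 \<longlonglongrightarrow> b 9 * m 9" "?t 22 \<longlonglongrightarrow> b 11 * m 11"
    using dbl[of 1] dbl[of 3] dbl[of 5] dbl[of 7] dbl[of 9] dbl[of 11] by simp_all
  \<comment> \<open>A product with a convergent partition series as reciprocal cannot vanish; the
    single residue 2a modulo 48 suffices.\<close>
  have nz: "b a * m a \<noteq> 0" if "0 < a" "a < 12" for a
    using pm_residues_gf(1)[of q "{2 * a}" 48 "b a * m a"] dbl[of a] that q by simp
  have m: "m 1 \<noteq> 0" "m 5 \<noteq> 0" "m 7 \<noteq> 0" "m 11 \<noteq> 0"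
    using nz[of 1] nz[of 5] nz[of 7] nz[of 11] by auto
  define Od where "Od = b 1 * b 3 * b 5 * b 7 * b 9 * b 11"
  \<comment> \<open>The residues 2, 6, 10, 14, 18, 22 are grouped in two ways: in pairs with sum 24,
    and each as the double of an odd number. Uniqueness of limits equates the results.\<close>
  have "(\<lambda>N. (?t 2 N * ?t 22 N) * (?t 6 N * ?t 18 N) * (?t 10 N * ?t 14 N)) \<longlonglongrightarrow> b 2 * b 6 * b 10"
    by (intro tendsto_mult p)
  moreover have "(\<lambda>N. (?t 2 N * ?t 22 N) * (?t 6 N * ?t 18 N) * (?t 10 N * ?t 14 N)) \<longlonglongrightarrow>
      ((b 1 * m 1) * (b 11 * m 11)) * ((b 3 * m 3) * (b 9 * m 9)) * ((b 5 * m 5) * (b 7 * m 7))"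
    by (intro tendsto_mult d)
  ultimately have "b 2 * b 6 * b 10 =
      ((b 1 * m 1) * (b 11 * m 11)) * ((b 3 * m 3) * (b 9 * m 9)) * ((b 5 * m 5) * (b 7 * m 7))"
    by (rule LIMSEQ_unique)
  then have odd: "b 2 * b 6 * b 10 = Od * (m 1 * m 3 * m 5 * m 7 * m 9 * m 11)"
    by (simp add: Od_def)

  \<comment> \<open>Each of the four sets consists of the pair 4, 20, four odd pairs with sum 24,
    and two numbers 2a with a odd. The latter supply the two \<open>b a\<close> missing from
    \<open>Od\<close>, leaving their \<open>m a\<close> as extra factors.\<close>
  have L1: "(\<lambda>N. \<Prod>r\<in>{1, 4, 5, 6, 7, 9, 15, 17, 19, 20, 22, 23}. ?t r N) \<longlonglongrightarrow> Od * b 4 * m 3 * m 11"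
  proof -
    have "(\<lambda>N. (?t 1 N * ?t 23 N) * (?t 4 N * ?t 20 N) * (?t 5 N * ?t 19 N) * (?t 7 N * ?t 17 N) *
        (?t 9 N * ?t 15 N) * ?t 6 N * ?t 22 N) \<longlonglongrightarrow> b 1 * b 4 * b 5 * b 7 * b 9 * (b 3 * m 3) * (b 11 * m 11)"
      by (intro tendsto_mult p d)
    then show ?thesis by (simp add: Od_def mult_ac)
  qed
  have L2: "(\<lambda>N. \<Prod>r\<in>{1, 3, 4, 5, 11, 13, 14, 18, 19, 20, 21, 23}. ?t r N) \<longlonglongrightarrow> Od * b 4 * m 7 * m 9"
  proof -
    have "(\<lambda>N. (?t 1 N * ?t 23 N) * (?t 4 N * ?t 20 N) * (?t 5 N * ?t 19 N) * (?t 3 N * ?t 21 N) *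
        (?t 11 N * ?t 13 N) * ?t 14 N * ?t 18 N) \<longlonglongrightarrow> b 1 * b 4 * b 5 * b 3 * b 11 * (b 7 * m 7) * (b 9 * m 9)"
      by (intro tendsto_mult p d)
    then show ?thesis by (simp add: Od_def mult_ac)
  qed
  have L3: "(\<lambda>N. \<Prod>r\<in>{2, 3, 4, 5, 7, 11, 13, 17, 18, 19, 20, 21}. ?t r N) \<longlonglongrightarrow> Od * b 4 * m 1 * m 9"
  proof -
    have "(\<lambda>N. (?t 3 N * ?t 21 N) * (?t 4 N * ?t 20 N) * (?t 5 N * ?t 19 N) * (?t 7 N * ?t 17 N) *
        (?t 11 N * ?t 13 N) * ?t 2 N * ?t 18 N) \<longlonglongrightarrow> b 3 * b 4 * b 5 * b 7 * b 11 * (b 1 * m 1) * (b 9 * m 9)"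
      by (intro tendsto_mult p d)
    then show ?thesis by (simp add: Od_def mult_ac)
  qed
  have L4: "(\<lambda>N. \<Prod>r\<in>{1, 4, 6, 7, 9, 10, 11, 13, 15, 17, 20, 23}. ?t r N) \<longlonglongrightarrow> Od * b 4 * m 3 * m 5"
  proof -
    have "(\<lambda>N. (?t 1 N * ?t 23 N) * (?t 4 N * ?t 20 N) * (?t 7 N * ?t 17 N) * (?t 9 N * ?t 15 N) *
        (?t 11 N * ?t 13 N) * ?t 6 N * ?t 10 N) \<longlonglongrightarrow> b 1 * b 4 * b 7 * b 9 * b 11 * (b 3 * m 3) * (b 5 * m 5)"
      by (intro tendsto_mult p d)
    then show ?thesis by (simp add: Od_def mult_ac)
  qed
  have G1: "Od * b 4 * m 3 * m 11 \<noteq> 0" "F {1, 4, 5, 6, 7, 9, 15, 17, 19, 20, 22, 23} sums (1 / (Od * b 4 * m 3 * m 11))"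
    using pm_residues_gf[OF q(2) _ _ _ L1] by (simp_all add: F_def)
  have G2: "Od * b 4 * m 7 * m 9 \<noteq> 0" "F {1, 3, 4, 5, 11, 13, 14, 18, 19, 20, 21, 23} sums (1 / (Od * b 4 * m 7 * m 9))"
    using pm_residues_gf[OF q(2) _ _ _ L2] by (simp_all add: F_def)
  have G3: "Od * b 4 * m 1 * m 9 \<noteq> 0" "F {2, 3, 4, 5, 7, 11, 13, 17, 18, 19, 20, 21} sums (1 / (Od * b 4 * m 1 * m 9))"
    using pm_residues_gf[OF q(2) _ _ _ L3] by (simp_all add: F_def)
  have G4: "Od * b 4 * m 3 * m 5 \<noteq> 0" "F {1, 4, 6, 7, 9, 10, 11, 13, 15, 17, 20, 23} sums (1 / (Od * b 4 * m 3 * m 5))"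
    using pm_residues_gf[OF q(2) _ _ _ L4] by (simp_all add: F_def)

  have eq1: "Od * b 4 * m 7 * m 9 - q * (Od * b 4 * m 3 * m 11) = (Od * b 4 * m 3 * m 11) * (Od * b 4 * m 7 * m 9)"
  proof -
    \<comment> \<open>The factor m 1 * m 5 completes both terms to those of \<open>id1\<close>; it
      is nonzero and cancels at the end.\<close>
    have "m 1 * m 5 * (Od * b 4 * m 7 * m 9 - q * (Od * b 4 * m 3 * m 11)) =
        Od * b 4 * (m 9 * m 7 * m 5 * m 1 - q * (m 11 * m 5 * m 3 * m 1))"
      by (simp add: algebra_simps)
    also have "\<dots> = Od * b 4 * b 4 * (b 2 * b 6 * b 10)"
      unfolding id1 by simp
    also have "\<dots> = m 1 * m 5 * ((Od * b 4 * m 3 * m 11) * (Od * b 4 * m 7 * m 9))"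
      unfolding odd by simp
    finally show ?thesis using m by simp
  qed
  have eq2: "Od * b 4 * m 1 * m 9 - Od * b 4 * m 3 * m 5 = q * ((Od * b 4 * m 1 * m 9) * (Od * b 4 * m 3 * m 5))"
  proof -
    \<comment> \<open>Here m 7 * m 11 is the factor that leads to \<open>id2\<close>.\<close>
    have "m 7 * m 11 * (Od * b 4 * m 1 * m 9 - Od * b 4 * m 3 * m 5) =
        Od * b 4 * (m 11 * m 9 * m 7 * m 1 - m 11 * m 7 * m 5 * m 3)"
      by (simp add: algebra_simps)
    also have "\<dots> = q * (Od * b 4 * b 4 * (b 2 * b 6 * b 10))"
      unfolding id2 by simp
    also have "\<dots> = m 7 * m 11 * (q * ((Od * b 4 * m 1 * m 9) * (Od * b 4 * m 3 * m 5)))"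
      unfolding odd by simp
    finally show ?thesis using m by simp
  qed
  have arith1: "1 / x - q * (1 / y) = 1" if "y - q * x = x * y" "x \<noteq> 0" "y \<noteq> 0" for x y :: real
    using that by (simp add: field_simps)
  have arith2: "1 / y - 1 / x = q" if "x - y = q * (x * y)" "x \<noteq> 0" "y \<noteq> 0" for x y :: real
    using that by (simp add: field_simps)
  show "\<exists>s t. F {1, 4, 5, 6, 7, 9, 15, 17, 19, 20, 22, 23} sums s \<and>
      F {1, 3, 4, 5, 11, 13, 14, 18, 19, 20, 21, 23} sums t \<and> s - q * t = 1"
    by (intro exI conjI, rule G1(2), rule G2(2), rule arith1[OF eq1 G1(1) G2(1)])
  show "\<exists>s t. F {2, 3, 4, 5, 7, 11, 13, 17, 18, 19, 20, 21} sums s \<and>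
      F {1, 4, 6, 7, 9, 10, 11, 13, 15, 17, 20, 23} sums t \<and> t - s = q"
    by (intro exI conjI, rule G3(2), rule G4(2), rule arith2[OF eq2 G3(1) G4(1)])
qed

section \<open>Comparison of coefficients\<close>

theorem theorem7p2:
  shows
    "(\<forall>S T.
        S = pm_residues {1, 4, 5, 6, 7, 9, 15, 17, 19, 20, 22, 23} 48 \<and>
        T = pm_residues {1, 3, 4, 5, 11, 13, 14, 18, 19, 20, 21, 23} 48 \<longrightarrow>
        (\<forall>n\<ge>1. num_partitions S n = num_partitions T (n - 1))) \<and>
     (\<forall>S T.
        S = pm_residues {2, 3, 4, 5, 7, 11, 13, 17, 18, 19, 20, 21} 48 \<and>
        T = pm_residues {1, 4, 6, 7, 9, 10, 11, 13, 15, 17, 20, 23} 48 \<longrightarrow>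
        (\<forall>n. n \<noteq> 1 \<longrightarrow> num_partitions S n = num_partitions T n))"
proof (intro conjI allI impI; elim conjE)
  fix S T :: "nat set" and n :: nat
  assume ST: "S = pm_residues {1, 4, 5, 6, 7, 9, 15, 17, 19, 20, 22, 23} 48"
    "T = pm_residues {1, 3, 4, 5, 11, 13, 14, 18, 19, 20, 21, 23} 48" and n: "1 \<le> n"
  \<comment> \<open>Coefficients of s - q t - 1. The guard is needed at k = 0, where the truncated k
    - 1 would count a partition of 0.\<close>
  define a where "a k = real (num_partitions S k) -
    (if 1 \<le> k then real (num_partitions T (k - 1)) else 0) - (if k = 0 then 1 else 0)" for k
  have "a n = 0"
  proof (rule powser_sums_zero_imp_coeff_zero)
    fix q :: real assume q: "q \<noteq> 0" "\<bar>q\<bar> < 1"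
    obtain s t where st: "(\<lambda>k. num_partitions S k * q ^ k) sums s"
      "(\<lambda>k. num_partitions T k * q ^ k) sums t" "s - q * t = 1"
      using gf_identities(1)[OF q] unfolding ST by blast
    have "(\<lambda>k. q * (num_partitions T k * q ^ k)) sums (q * t)"
      by (intro sums_mult st)
    then have "(\<lambda>k. if 1 \<le> k then num_partitions T (k - 1) * q ^ k else 0) sums (q * t)"
      by (subst sums_zero_iff_shift[of 1, symmetric]) (auto simp: mult_ac)
    note sums_diff[OF sums_diff[OF st(1) this] sums_single[of 0 "\<lambda>_. 1 :: real"]]
    moreover have "a k * q ^ k = num_partitions S k * q ^ k -
        (if 1 \<le> k then num_partitions T (k - 1) * q ^ k else 0) - (if k = 0 then 1 else 0)" for k
      by (cases k) (simp_all add: a_def algebra_simps)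
    ultimately show "(\<lambda>k. a k * q ^ k) sums 0"
      using st(3) by simp
  qed
  then show "num_partitions S n = num_partitions T (n - 1)"
    using n by (simp add: a_def)
next
  fix S T :: "nat set" and n :: nat
  assume ST: "S = pm_residues {2, 3, 4, 5, 7, 11, 13, 17, 18, 19, 20, 21} 48"
    "T = pm_residues {1, 4, 6, 7, 9, 10, 11, 13, 15, 17, 20, 23} 48" and n: "n \<noteq> 1"
  \<comment> \<open>Coefficients of t - s - q; the correction sits only at the excluded index
    1.\<close>
  define a where "a k = real (num_partitions T k) - real (num_partitions S k) - (if k = 1 then 1 else 0)" for k
  have "a n = 0"
  proof (rule powser_sums_zero_imp_coeff_zero)
    fix q :: real assume q: "q \<noteq> 0" "\<bar>q\<bar> < 1"
    obtain s t where st: "(\<lambda>k. num_partitions S k * q ^ k) sums s"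
      "(\<lambda>k. num_partitions T k * q ^ k) sums t" "t - s = q"
      using gf_identities(2)[OF q] unfolding ST by blast
    note sums_diff[OF sums_diff[OF st(2,1)] sums_single[of 1 "\<lambda>k. q ^ k"]]
    moreover have "a k * q ^ k = num_partitions T k * q ^ k - num_partitions S k * q ^ k -
        (if k = 1 then q ^ k else 0)" for k
      by (simp add: a_def algebra_simps)
    ultimately show "(\<lambda>k. a k * q ^ k) sums 0"
      using st(3) by simp
  qed
  then show "num_partitions S n = num_partitions T n"
    using n by (simp add: a_def)
qed

end
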